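(* Let $N\in\mathbb{N}$ and let $\Omega\subset\mathbb{R}^N$ be a bounded domain with connected Lipschitz boundary $\Gamma:=\partial\Omega$. Let $c_m>0$ be a Maxwell constant for $\Omega$, i.e. a positive constant such that $$\|v\|_{L^2(\Omega)}\le c_m\big(\|\operatorname{curl}v\|_{L^2(\Omega)}^2+\|\operatorname{div}v\|_{L^2(\Omega)}^2\big)^{1/2}\qquad\text{for all }v\in \mathring{H}(\operatorname{curl};\Omega)\cap H(\operatorname{div};\Omega),$$ and set $\hat c:=\max\{2,\sqrt5\,c_m\}$. Then the inequality $$\|\operatorname{Grad}v\|_{L^2(\Omega)}\le\hat c\,\|\operatorname{sym}\operatorname{Grad}v\|_{L^2(\Omega)}$$ holds for all $v\in\mathring{H}(\operatorname{Grad};\Omega)$. Moreover, $$\operatorname{Grad}\mathring{H}(\operatorname{Grad};\Omega)=\mathring{H}(\operatorname{Curl}_0;\Omega),$$ and the same inequality holds for all $v\in H(\operatorname{Grad};\Omega)$ with $\operatorname{Grad}v\in\mathring{H}(\operatorname{Curl}_0;\Omega)$ (i.e. with $\operatorname{grad}v_n$, $n=1,\dots,N$, normal at $\Gamma$ in the weak sense).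
   Context: All functions are real-valued and $L^2(\Omega)$ denotes $L^2(\Omega,\mathbb{R}^k)$ for the appropriate $k$, with the Euclidean (for matrices: Frobenius) norm on values. For a vector field $v:\Omega\to\mathbb{R}^N$, $\operatorname{curl}v$ is the $\mathbb{R}^{(N-1)N/2}$-valued field with entries $\partial_n v_m-\partial_m v_n$, $1\le n<m\le N$ (the exterior derivative of the $1$-form identified with $v$), and $\operatorname{div}v=\sum_n\partial_n v_n$; both are understood in the weak (distributional) sense. Define $$H(\operatorname{curl};\Omega):=\{v\in L^2(\Omega,\mathbb{R}^N):\operatorname{curl}v\in L^2(\Omega,\mathbb{R}^{(N-1)N/2})\},$$ $$H(\operatorname{div};\Omega):=\{v\in L^2(\Omega,\mathbb{R}^N):\operatorname{div}v\in L^2(\Omega,\mathbb{R})\},$$ and let $\mathring{H}(\operatorname{curl};\Omega)$ be the closure of the compactly supported smooth vector fields $C_c^\infty(\Omega,\mathbb{R}^N)$ in $H(\operatorname{curl};\Omega)$ with respect to the graph norm $(\|v\|_{L^2(\Omega)}^2+\|\operatorname{curl}v\|_{L^2(\Omega)}^2)^{1/2}$; this generalizes the homogeneous tangential boundary condition on $\Gamma$. For the domains considered, a constant $c_m$ as in the claim exists. $H(\operatorname{Grad};\Omega)=H^1(\Omega,\mathbb{R}^N)$ is the space of vector fields whose components are in the Sobolev space $H^1(\Omega)$, and $\mathring{H}(\operatorname{Grad};\Omega)=H^1_0(\Omega,\mathbb{R}^N)$ is the space of vector fields whose components are in the $H^1$-closure of $C_c^\infty(\Omega)$. $\operatorname{Grad}v$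 is the Jacobian of $v$, i.e. the $N\times N$ tensor field whose $n$-th row is $(\operatorname{grad}v_n)^T$. For a tensor field $P:\Omega\to\mathbb{R}^{N\times N}$ with rows $P_1,\dots,P_N$, $\operatorname{Curl}P$ is the $N\times(N-1)N/2$ tensor field whose $n$-th row is $\operatorname{curl}P_n$. $\mathring{H}(\operatorname{Curl};\Omega)$ is the space of tensor fields all of whose rows belong to $\mathring{H}(\operatorname{curl};\Omega)$, and $\mathring{H}(\operatorname{Curl}_0;\Omega):=\{P\in\mathring{H}(\operatorname{Curl};\Omega):\operatorname{Curl}P=0\}$. Finally $\operatorname{sym}P:=\frac12(P+P^T)$. *)

theory Defs
  imports "HOL-Analysis.Analysis"
begin

text \<open>Near each boundary point the set lies strictly below the graph of a Lipschitz function over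
  the hyperplane orthogonal to a unit vector \<open>e\<close>; a choice of \<open>e\<close> is the choice of a Euclidean
  coordinate system with last axis \<open>e\<close>.\<close>

definition lipschitz_boundary :: "(real^'n) set \<Rightarrow> bool" where
  "lipschitz_boundary \<Omega> \<longleftrightarrow>
     (\<forall>x\<in>frontier \<Omega>. \<exists>r>0. \<exists>e. \<exists>L. \<exists>\<phi> :: real^'n \<Rightarrow> real.
        norm e = 1 \<and> L-lipschitz_on {z. z \<bullet> e = 0} \<phi> \<and>
        \<Omega> \<inter> ball x r = {y \<in> ball x r. y \<bullet> e < \<phi> (y - (y \<bullet> e) *\<^sub>R e)})"

definition partial_deriv ::
  "'n \<Rightarrow> (real^'n \<Rightarrow> 'b::real_normed_vector) \<Rightarrow> real^'n \<Rightarrow> 'b" where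
  "partial_deriv i f x = frechet_derivative f (at x) (axis i 1)"

primrec C_k :: "nat \<Rightarrow> (real^'n \<Rightarrow> 'b::real_normed_vector) \<Rightarrow> bool" where
  "C_k 0 f \<longleftrightarrow> continuous_on UNIV f"
| "C_k (Suc k) f \<longleftrightarrow> (\<forall>x. f differentiable (at x)) \<and> (\<forall>i. C_k k (partial_deriv i f))"

text \<open>The elements of \<open>C\<^sub>c\<^sup>\<infinity>(\<Omega>)\<close> are extended by zero to the whole space.\<close>

definition Cc_inf :: "(real^'n) set \<Rightarrow> (real^'n \<Rightarrow> 'b::real_normed_vector) set" where
  "Cc_inf \<Omega> = {\<phi>. (\<forall>k. C_k k \<phi>) \<and> compact (closure {x. \<phi> x \<noteq> 0}) \<and> closure {x. \<phi> x \<noteq> 0} \<subseteq> \<Omega>}"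

text \<open>Fields are functions, not classes modulo null sets. All the sets and relations on fields
  below are invariant under changing fields on a null subset of \<open>\<Omega>\<close> (and outside \<open>\<Omega>\<close>), so that
  equality of two such sets is equality of the corresponding sets of classes.
  The library norm on \<open>real^'m^'n\<close> is the Frobenius norm.\<close>

definition L2 :: "(real^'n) set \<Rightarrow> (real^'n \<Rightarrow> 'b::euclidean_space) set" where
  "L2 \<Omega> = {f. f \<in> borel_measurable (lebesgue_on \<Omega>) \<and>
              integrable (lebesgue_on \<Omega>) (\<lambda>x. (norm (f x))\<^sup>2)}"

definition L2_norm :: "(real^'n) set \<Rightarrow> (real^'n \<Rightarrow> 'b::euclidean_space) \<Rightarrow> real" where
  "L2_norm \<Omega> f = sqrt (\<integral>x. (norm (f x))\<^sup>2 \<partial>(lebesgue_on \<Omega>))"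

text \<open>The operators are given as relations: \<open>has_curl \<Omega> v w\<close> says that \<open>v\<close> and \<open>w\<close> are in \<open>L\<^sup>2(\<Omega>)\<close>
  and that \<open>w\<close> is a representative of the weak curl of \<open>v\<close>.\<close>

definition has_grad :: "(real^'n) set \<Rightarrow> (real^'n \<Rightarrow> real) \<Rightarrow> (real^'n \<Rightarrow> real^'n) \<Rightarrow> bool" where
  "has_grad \<Omega> u g \<longleftrightarrow> u \<in> L2 \<Omega> \<and> g \<in> L2 \<Omega> \<and>
     (\<forall>\<phi>\<in>Cc_inf \<Omega>. \<forall>i.
        (\<integral>x. u x * partial_deriv i \<phi> x \<partial>(lebesgue_on \<Omega>)) =
        - (\<integral>x. g x $ i * \<phi> x \<partial>(lebesgue_on \<Omega>)))"

definition has_div :: "(real^'n) set \<Rightarrow> (real^'n \<Rightarrow> real^'n) \<Rightarrow> (real^'n \<Rightarrow> real) \<Rightarrow> bool" where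
  "has_div \<Omega> v d \<longleftrightarrow> v \<in> L2 \<Omega> \<and> d \<in> L2 \<Omega> \<and>
     (\<forall>\<phi>\<in>Cc_inf \<Omega>.
        (\<integral>x. (\<Sum>n\<in>UNIV. v x $ n * partial_deriv n \<phi> x) \<partial>(lebesgue_on \<Omega>)) =
        - (\<integral>x. d x * \<phi> x \<partial>(lebesgue_on \<Omega>)))"

text \<open>The values of the curl, indexed by the pairs \<open>n < m\<close>, are stored as strictly upper triangular
  matrices: the entry \<open>(n, m)\<close> is \<open>\<partial>\<^sub>n v\<^sub>m - \<partial>\<^sub>m v\<^sub>n\<close> for \<open>n < m\<close> and zero otherwise, so that the
  Frobenius norm of the matrix is the Euclidean norm of the vector of \<open>N(N-1)/2\<close> entries.
  Every finite linear order is a well-order, so the class \<open>wellorder\<close> is no restriction on \<open>N\<close>.\<close>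

definition has_curl :: "(real^'n::{finite,wellorder}) set \<Rightarrow> (real^'n::_ \<Rightarrow> real^'n::_) \<Rightarrow>
    (real^'n::_ \<Rightarrow> real^'n::_^'n::_) \<Rightarrow> bool" where
  "has_curl \<Omega> v w \<longleftrightarrow> v \<in> L2 \<Omega> \<and> w \<in> L2 \<Omega> \<and>
     (\<forall>\<phi>\<in>Cc_inf \<Omega>. \<forall>n m.
        (if n < m
         then (\<integral>x. v x $ m * partial_deriv n \<phi> x - v x $ n * partial_deriv m \<phi> x
                 \<partial>(lebesgue_on \<Omega>))
         else 0) =
        - (\<integral>x. w x $ n $ m * \<phi> x \<partial>(lebesgue_on \<Omega>)))"

definition has_Grad :: "(real^'n) set \<Rightarrow> (real^'n \<Rightarrow> real^'n) \<Rightarrow> (real^'n \<Rightarrow> real^'n^'n) \<Rightarrow> bool" where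
  "has_Grad \<Omega> v P \<longleftrightarrow> (\<forall>n. has_grad \<Omega> (\<lambda>x. v x $ n) (\<lambda>x. P x $ n))"

definition has_Curl :: "(real^'n::{finite,wellorder}) set \<Rightarrow> (real^'n::_ \<Rightarrow> real^'n::_^'n::_) \<Rightarrow>
    (real^'n::_ \<Rightarrow> real^'n::_^'n::_^'n::_) \<Rightarrow> bool" where
  "has_Curl \<Omega> P W \<longleftrightarrow> (\<forall>n. has_curl \<Omega> (\<lambda>x. P x $ n) (\<lambda>x. W x $ n))"

text \<open>Closure of \<open>C\<^sub>c\<^sup>\<infinity>(\<Omega>)\<close> in the domain of the operator \<open>D\<close> with respect to the graph norm.\<close>

definition Cc_closure :: "(real^'n) set \<Rightarrow>
    ((real^'n \<Rightarrow> 'b::euclidean_space) \<Rightarrow> (real^'n \<Rightarrow> 'c::euclidean_space) \<Rightarrow> bool) \<Rightarrow>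
    (real^'n \<Rightarrow> 'b) set" where
  "Cc_closure \<Omega> D = {v. (\<exists>w. D v w) \<and>
     (\<forall>\<epsilon>>0. \<exists>\<phi>\<in>Cc_inf \<Omega>. \<exists>z. D (\<lambda>x. v x - \<phi> x) z \<and>
        sqrt ((L2_norm \<Omega> (\<lambda>x. v x - \<phi> x))\<^sup>2 + (L2_norm \<Omega> z)\<^sup>2) < \<epsilon>)}"

definition H1 :: "(real^'n) set \<Rightarrow> (real^'n \<Rightarrow> real) set" where
  "H1 \<Omega> = {u. \<exists>g. has_grad \<Omega> u g}"

definition H1_0 :: "(real^'n) set \<Rightarrow> (real^'n \<Rightarrow> real) set" where
  "H1_0 \<Omega> = Cc_closure \<Omega> (has_grad \<Omega>)"

definition H_Grad :: "(real^'n) set \<Rightarrow> (real^'n \<Rightarrow> real^'n) set" where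
  "H_Grad \<Omega> = {v. \<forall>n. (\<lambda>x. v x $ n) \<in> H1 \<Omega>}"

definition H0_Grad :: "(real^'n) set \<Rightarrow> (real^'n \<Rightarrow> real^'n) set" where
  "H0_Grad \<Omega> = {v. \<forall>n. (\<lambda>x. v x $ n) \<in> H1_0 \<Omega>}"

definition H_div :: "(real^'n) set \<Rightarrow> (real^'n \<Rightarrow> real^'n) set" where
  "H_div \<Omega> = {v. \<exists>d. has_div \<Omega> v d}"

definition H0_curl :: "(real^'n::{finite,wellorder}) set \<Rightarrow> (real^'n::_ \<Rightarrow> real^'n::_) set" where
  "H0_curl \<Omega> = Cc_closure \<Omega> (has_curl \<Omega>)"

definition H0_Curl :: "(real^'n::{finite,wellorder}) set \<Rightarrow> (real^'n::_ \<Rightarrow> real^'n::_^'n::_) set" where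
  "H0_Curl \<Omega> = {P. \<forall>n. (\<lambda>x. P x $ n) \<in> H0_curl \<Omega>}"

definition H0_Curl0 :: "(real^'n::{finite,wellorder}) set \<Rightarrow> (real^'n::_ \<Rightarrow> real^'n::_^'n::_) set" where
  "H0_Curl0 \<Omega> = {P \<in> H0_Curl \<Omega>. has_Curl \<Omega> P (\<lambda>x. 0)}"

definition Grad_image :: "(real^'n) set \<Rightarrow> (real^'n \<Rightarrow> real^'n) set \<Rightarrow>
    (real^'n \<Rightarrow> real^'n^'n) set" where
  "Grad_image \<Omega> V = {P. \<exists>v\<in>V. has_Grad \<Omega> v P}"

definition sym_part :: "real^'n^'n \<Rightarrow> real^'n^'n" where
  "sym_part A = (1/2) *\<^sub>R (A + transpose A)"

end

theory Submission
  imports Defs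
begin

text \<open>The inequality is Korn's first inequality. For a test field with Jacobian \<open>Q\<close>, two partial
  integrations turn \<open>\<integral> Q \<bullet> Q\<^sup>T\<close> into \<open>\<integral> (tr Q)\<^sup>2 \<ge> 0\<close>, so the pointwise identity
  \<open>2 \<bar>sym Q\<bar>\<^sup>2 = \<bar>Q\<bar>\<^sup>2 + Q \<bullet> Q\<^sup>T\<close> gives \<open>\<parallel>Q\<parallel> \<le> \<surd>2 \<parallel>sym Q\<parallel>\<close> (\<open>Korn_test_fields\<close>); density extends this to
  vector fields with components in \<open>H\<^sup>1\<^sub>0\<close> (\<open>Korn_H0_Grad\<close>), and \<open>\<surd>2 \<le> 2\<close>.

  The identity \<open>Grad H\<^sup>1\<^sub>0 = H\<^sub>0(Curl\<^sub>0)\<close> is proved row by row. A gradient of an \<open>H\<^sup>1\<^sub>0\<close> function is curl-free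
  because mixed derivatives of test functions commute (\<open>has_curl_grad\<close>), and it is approximated by gradients of test
  functions, which are test fields (\<open>gradient_in_H0_curl\<close>). Conversely, let \<open>p\<close> be a curl-free
  element of \<open>H\<^sub>0(curl)\<close> and project it orthogonally in \<open>L\<^sup>2\<close> onto the gradients of \<open>H\<^sup>1\<^sub>0\<close>. The remainder
  is still a curl-free element of \<open>H\<^sub>0(curl)\<close>, and being orthogonal to all gradients of test
  functions it has vanishing weak divergence. The Maxwell inequality then bounds its norm by zero,
  so \<open>p\<close> is a gradient (\<open>curl_free_is_gradient\<close>). The last claim follows from the
  other two: such a tensor field is also the gradient of some field with vanishing boundary values.

  The projection exists (\<open>orthogonal_projection_onto_gradients\<close>) because \<open>L\<^sup>2\<close> is complete
  (\<open>L2_complete\<close>) and because the Poincare inequality (\<open>Poincare\<close>) turns convergence of gradients into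
  convergence of the potentials. As fields are functions and not classes, and gradients are given
  as relations, different weak gradients of the same function have to be compared; their
  uniqueness almost everywhere rests on the fundamental lemma of the calculus of variations
  (\<open>fundamental_lemma\<close>), for which smooth bump functions on boxes are constructed from \<open>exp (- 1 / t)\<close>.\<close>

section \<open>Functions of class \<open>C\<^sup>k\<close>\<close>

lemma partial_deriv_eq:
  assumes "(f has_derivative D) (at x)"
  shows "partial_deriv i f x = D (axis i 1)"
  using frechet_derivative_at[OF assms] by (simp add: partial_deriv_def)

lemma partial_deriv_bounded_linear:
  assumes "bounded_linear T" "\<forall>x. f differentiable (at x)"
  shows "partial_deriv i (\<lambda>x. T (f x)) = (\<lambda>x. T (partial_deriv i f x))"
proof
  fix x
  have "(f has_derivative frechet_derivative f (at x)) (at x)"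
    using assms(2) frechet_derivative_works by blast
  from partial_deriv_eq[OF bounded_linear.has_derivative[OF assms(1) this]]
  show "partial_deriv i (\<lambda>x. T (f x)) x = T (partial_deriv i f x)"
    by (simp add: partial_deriv_def[of i f x])
qed

lemma partial_deriv_add:
  assumes "\<forall>x. f differentiable (at x)" "\<forall>x. g differentiable (at x)"
  shows "partial_deriv i (\<lambda>x. f x + g x) = (\<lambda>x. partial_deriv i f x + partial_deriv i g x)"
proof
  fix x
  have "((\<lambda>x. f x + g x) has_derivative
      (\<lambda>h. frechet_derivative f (at x) h + frechet_derivative g (at x) h)) (at x)"
    using assms by (intro has_derivative_add) (simp_all flip: frechet_derivative_works)
  from partial_deriv_eq[OF this] show "partial_deriv i (\<lambda>x. f x + g x) x = partial_deriv i f x + partial_deriv i g x"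
    by (simp add: partial_deriv_def[of i f x] partial_deriv_def[of i g x])
qed

lemma partial_deriv_mult:
  fixes f g :: "real^'n \<Rightarrow> real"
  assumes "\<forall>x. f differentiable (at x)" "\<forall>x. g differentiable (at x)"
  shows "partial_deriv i (\<lambda>x. f x * g x) = (\<lambda>x. f x * partial_deriv i g x + partial_deriv i f x * g x)"
proof
  fix x
  have "((\<lambda>x. f x * g x) has_derivative
      (\<lambda>h. f x * frechet_derivative g (at x) h + frechet_derivative f (at x) h * g x)) (at x)"
    using assms by (intro has_derivative_mult) (simp_all flip: frechet_derivative_works)
  from partial_deriv_eq[OF this] show "partial_deriv i (\<lambda>x. f x * g x) x = f x * partial_deriv i g x + partial_deriv i f x * g x"
    by (simp add: partial_deriv_def[of i f x] partial_deriv_def[of i g x])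
qed

lemma C_k_Suc_imp_C_k: "C_k (Suc k) f \<Longrightarrow> C_k k f"
proof (induction k arbitrary: f)
  case 0
  then have "\<forall>x. f differentiable (at x)" by simp
  then have "isCont f x" for x
    using differentiable_imp_continuous_within by blast
  then show ?case
    by (simp add: continuous_at_imp_continuous_on)
next
  case (Suc k)
  have "C_k (Suc k) (partial_deriv i f)" for i
    using Suc.prems by (simp only: C_k.simps(2)[of "Suc k" f])
  then have "C_k k (partial_deriv i f)" for i
    by (rule Suc.IH)
  with Suc.prems show ?case by simp
qed

lemma C_k_bounded_linear:
  assumes "bounded_linear T"
  shows "C_k k f \<Longrightarrow> C_k k (\<lambda>x. T (f x))"
proof (induction k arbitrary: f)
  case 0
  then show ?case
    using assms by (auto intro: bounded_linear.continuous_on)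
next
  case (Suc k)
  have "(\<lambda>x. T (f x)) differentiable (at x)" for x
    using Suc.prems bounded_linear.has_derivative[OF assms] unfolding differentiable_def C_k.simps by blast
  with Suc show ?case
    by (simp add: partial_deriv_bounded_linear[OF assms])
qed

lemma C_k_add: "C_k k f \<Longrightarrow> C_k k g \<Longrightarrow> C_k k (\<lambda>x. f x + g x)"
  by (induction k arbitrary: f g) (auto intro: continuous_intros simp: partial_deriv_add)

lemma C_k_mult:
  fixes f g :: "real^'n \<Rightarrow> real"
  shows "C_k k f \<Longrightarrow> C_k k g \<Longrightarrow> C_k k (\<lambda>x. f x * g x)"
proof (induction k arbitrary: f g)
  case 0
  then show ?case by (auto intro: continuous_intros)
next
  case (Suc k)
  then have "C_k k f" "C_k k g"
    by (blast intro: C_k_Suc_imp_C_k)+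
  then show ?case
    using Suc by (auto simp: partial_deriv_mult intro!: C_k_add)
qed

lemma partial_deriv_const: "partial_deriv i (\<lambda>x. c) = (\<lambda>x. 0)"
  by (rule ext) (simp add: partial_deriv_eq[OF has_derivative_const])

lemma C_k_const: "C_k k (\<lambda>x. c)"
  by (induction k arbitrary: c) (auto simp: partial_deriv_const)

lemma C_k_prod:
  fixes f :: "'i \<Rightarrow> real^'n \<Rightarrow> real"
  shows "(\<And>i. i \<in> I \<Longrightarrow> C_k k (f i)) \<Longrightarrow> C_k k (\<lambda>x. \<Prod>i\<in>I. f i x)"
  by (induction I rule: infinite_finite_induct) (auto intro: C_k_mult C_k_const)

lemma partial_deriv_coord: "partial_deriv j (\<lambda>x::real^'n. x $ i) = (\<lambda>x. if i = j then 1 else 0)"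
  by (rule ext)
     (simp add: partial_deriv_eq[OF bounded_linear_imp_has_derivative[OF bounded_linear_vec_nth]]
        axis_def)

lemma C_k_coord: "C_k k (\<lambda>x::real^'n. x $ i)"
proof (cases k)
  case 0
  then show ?thesis by (auto intro: continuous_intros)
next
  case (Suc k')
  have "(\<lambda>x::real^'n. x $ i) differentiable (at x)" for x
    using bounded_linear_imp_has_derivative[OF bounded_linear_vec_nth] by (auto simp: differentiable_def)
  with Suc show ?thesis
    by (auto simp: partial_deriv_coord C_k_const)
qed

lemma has_real_derivative_along_axis:
  fixes g :: "real^'n \<Rightarrow> real"
  assumes "\<forall>x. g differentiable (at x)"
  shows "((\<lambda>s. g (y + s *\<^sub>R axis l 1)) has_real_derivative
    partial_deriv l g (y + s *\<^sub>R axis l 1)) (at s)"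
proof -
  have "(g has_derivative frechet_derivative g (at (y + s *\<^sub>R axis l 1))) (at (y + s *\<^sub>R axis l 1))"
    using assms frechet_derivative_works by blast
  moreover have "((\<lambda>s. y + s *\<^sub>R axis l 1) has_derivative (\<lambda>t. t *\<^sub>R axis l 1)) (at s)"
    by (auto intro!: derivative_eq_intros)
  ultimately have *: "((\<lambda>s. g (y + s *\<^sub>R axis l 1)) has_derivative
      (\<lambda>t. frechet_derivative g (at (y + s *\<^sub>R axis l 1)) (t *\<^sub>R axis l 1))) (at s)"
    by (rule has_derivative_compose[rotated])
  have lin: "linear (frechet_derivative g (at (y + s *\<^sub>R axis l 1)))"
    using assms by (simp add: linear_frechet_derivative)
  show ?thesis
    using * unfolding has_field_derivative_def partial_deriv_def
    by (simp add: linear_cmul[OF lin] mult.commute[of _ "frechet_derivative _ _ _"])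
qed

text \<open>The second difference of \<open>f\<close> over a small square does not depend on the order of the two
  differences. Applying the mean value theorem first along \<open>i\<close> and then along \<open>j\<close> turns it into a
  value of one mixed derivative, and the opposite order gives the other one; continuity then
  makes the two mixed derivatives agree.\<close>

lemma double_difference:
  fixes f :: "real^'n \<Rightarrow> real"
  assumes "C_k 2 f" "h > 0"
  shows "\<exists>z\<in>ball x (3 * h).
    f (x + h *\<^sub>R axis i 1 + h *\<^sub>R axis j 1) - f (x + h *\<^sub>R axis i 1) - f (x + h *\<^sub>R axis j 1) + f x
      = h * h * partial_deriv j (partial_deriv i f) z"
proof -
  let ?a = "axis i 1 :: real^'n" and ?b = "axis j 1 :: real^'n"
  have df: "\<forall>x. f differentiable (at x)" "\<forall>x. partial_deriv i f differentiable (at x)"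
    using assms(1) by (simp_all add: numeral_2_eq_2)
  have "\<exists>s. 0 < s \<and> s < h \<and>
      (f (x + h *\<^sub>R ?b + h *\<^sub>R ?a) - f (x + h *\<^sub>R ?a)) - (f (x + h *\<^sub>R ?b + 0 *\<^sub>R ?a) - f (x + 0 *\<^sub>R ?a))
      = (h - 0) * (partial_deriv i f (x + h *\<^sub>R ?b + s *\<^sub>R ?a) - partial_deriv i f (x + s *\<^sub>R ?a))"
    by (rule MVT2[OF assms(2)], rule DERIV_diff) (intro has_real_derivative_along_axis df)+
  then obtain s where s: "0 < s" "s < h" and
    1: "f (x + h *\<^sub>R ?b + h *\<^sub>R ?a) - f (x + h *\<^sub>R ?a) - (f (x + h *\<^sub>R ?b) - f x)
      = h * (partial_deriv i f (x + h *\<^sub>R ?b + s *\<^sub>R ?a) - partial_deriv i f (x + s *\<^sub>R ?a))"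
    by auto
  have "\<exists>t. 0 < t \<and> t < h \<and>
      partial_deriv i f (x + s *\<^sub>R ?a + h *\<^sub>R ?b) - partial_deriv i f (x + s *\<^sub>R ?a + 0 *\<^sub>R ?b)
      = (h - 0) * partial_deriv j (partial_deriv i f) (x + s *\<^sub>R ?a + t *\<^sub>R ?b)"
    by (rule MVT2[OF assms(2)]) (intro has_real_derivative_along_axis df)
  then obtain t where t: "0 < t" "t < h" and
    2: "partial_deriv i f (x + s *\<^sub>R ?a + h *\<^sub>R ?b) - partial_deriv i f (x + s *\<^sub>R ?a)
      = h * partial_deriv j (partial_deriv i f) (x + s *\<^sub>R ?a + t *\<^sub>R ?b)"
    by auto
  have "dist x (x + s *\<^sub>R ?a + t *\<^sub>R ?b) = norm (s *\<^sub>R ?a + t *\<^sub>R ?b)"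
    by (subst dist_commute) (simp add: dist_norm add.assoc)
  also have "\<dots> \<le> s + t"
    using s t norm_triangle_ineq[of "s *\<^sub>R ?a" "t *\<^sub>R ?b"] by simp
  finally have "x + s *\<^sub>R ?a + t *\<^sub>R ?b \<in> ball x (3 * h)"
    using s t by simp
  moreover have "x + h *\<^sub>R ?a + h *\<^sub>R ?b = x + h *\<^sub>R ?b + h *\<^sub>R ?a" "x + s *\<^sub>R ?a + h *\<^sub>R ?b = x + h *\<^sub>R ?b + s *\<^sub>R ?a"
    by (simp_all add: algebra_simps)
  ultimately show ?thesis
    using 1 2 by (intro bexI[of _ "x + s *\<^sub>R ?a + t *\<^sub>R ?b"]) (simp_all add: algebra_simps)
qed

lemma mixed_partial_deriv_commute:
  fixes f :: "real^'n \<Rightarrow> real"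
  assumes "C_k 2 f"
  shows "partial_deriv i (partial_deriv j f) x = partial_deriv j (partial_deriv i f) x"
proof -
  let ?p = "partial_deriv i (partial_deriv j f)" and ?q = "partial_deriv j (partial_deriv i f)"
  have cont: "continuous_on UNIV ?p" "continuous_on UNIV ?q"
    using assms by (simp_all add: numeral_2_eq_2)
  have "dist (?p x) (?q x) \<le> e" if "e > 0" for e
  proof -
    have "e / 2 > 0" using that by simp
    then obtain d1 d2 where d: "d1 > 0" "d2 > 0"
      "\<And>y. dist y x < d1 \<Longrightarrow> dist (?p y) (?p x) < e / 2"
      "\<And>y. dist y x < d2 \<Longrightarrow> dist (?q y) (?q x) < e / 2"
      using cont unfolding continuous_on_iff by (metis UNIV_I)
    define h where "h = min d1 d2 / 3"
    have h: "h > 0" "3 * h \<le> d1" "3 * h \<le> d2" using d by (auto simp: h_def)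
    obtain z w where zw: "z \<in> ball x (3 * h)" "w \<in> ball x (3 * h)" "h * h * ?q z = h * h * ?p w"
      using double_difference[OF assms h(1), of x i j] double_difference[OF assms h(1), of x j i]
      by (auto simp: algebra_simps)
    then have "?q z = ?p w" using h by simp
    moreover have "dist z x < d2" "dist w x < d1"
      using zw h by (auto simp: dist_commute)
    then have "dist (?q z) (?q x) < e / 2" "dist (?p w) (?p x) < e / 2"
      using d by blast+
    ultimately show ?thesis
      using dist_triangle[of "?p x" "?q x" "?p w"] dist_commute[of "?p x" "?p w"] by simp
  qed
  then show ?thesis
    using dense_ge[of 0 "dist (?p x) (?q x)"] by simp
qed

section \<open>Test functions\<close>

lemma Cc_infI:
  assumes "\<And>k. C_k k \<phi>" "compact K" "K \<subseteq> \<Omega>" "\<And>x. x \<notin> K \<Longrightarrow> \<phi> x = 0"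
  shows "\<phi> \<in> Cc_inf \<Omega>"
proof -
  have "closure {x. \<phi> x \<noteq> 0} \<subseteq> K"
    using assms by (intro closure_minimal) (auto intro: compact_imp_closed)
  moreover from this have "bounded {x. \<phi> x \<noteq> 0}"
    by (rule bounded_subset[OF compact_imp_bounded[OF assms(2)] subset_trans[OF closure_subset]])
  ultimately show ?thesis
    using assms(1,3) by (auto simp: Cc_inf_def)
qed

lemma Cc_infE:
  assumes "\<phi> \<in> Cc_inf \<Omega>"
  obtains K where "\<And>k. C_k k \<phi>" "compact K" "K \<subseteq> \<Omega>" "\<And>x. x \<notin> K \<Longrightarrow> \<phi> x = 0"
proof (rule that)
  let ?K = "closure {x. \<phi> x \<noteq> 0}"
  show "compact ?K" "?K \<subseteq> \<Omega>" "C_k k \<phi>" for k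
    using assms unfolding Cc_inf_def by blast+
  show "\<phi> x = 0" if "x \<notin> ?K" for x
    using that closure_subset[of "{x. \<phi> x \<noteq> 0}"] by blast
qed

lemma partial_deriv_outside:
  assumes "closed K" "\<And>x. x \<notin> K \<Longrightarrow> \<phi> x = 0" "x \<notin> K"
  shows "partial_deriv i \<phi> x = 0"
proof -
  have "(\<phi> has_derivative (\<lambda>h. 0)) (at x)"
    by (rule has_derivative_transform_within_open[OF has_derivative_const[of 0], of "- K"])
       (use assms in auto)
  then show ?thesis by (simp add: partial_deriv_eq)
qed

lemma Cc_inf_C_k: "\<phi> \<in> Cc_inf \<Omega> \<Longrightarrow> C_k k \<phi>"
  by (simp add: Cc_inf_def)

lemma Cc_inf_differentiable: "\<phi> \<in> Cc_inf \<Omega> \<Longrightarrow> \<forall>x. \<phi> differentiable (at x)"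
  using Cc_inf_C_k[of \<phi> \<Omega> "Suc 0"] by simp

lemma Cc_inf_continuous: "\<phi> \<in> Cc_inf \<Omega> \<Longrightarrow> continuous_on UNIV \<phi>"
  using Cc_inf_C_k[of \<phi> \<Omega> 0] by simp

lemma Cc_inf_zero: "(\<lambda>x. 0) \<in> Cc_inf \<Omega>"
  by (rule Cc_infI[of _ "{}"]) (auto intro: C_k_const)

lemma Cc_inf_partial_deriv: 
  assumes "\<phi> \<in> Cc_inf \<Omega>" shows "partial_deriv i \<phi> \<in> Cc_inf \<Omega>"
  using assms
proof (rule Cc_infE)
  fix K assume K: "\<And>k. C_k k \<phi>" "compact K" "K \<subseteq> \<Omega>" "\<And>x. x \<notin> K \<Longrightarrow> \<phi> x = 0"
  show ?thesis
  proof (rule Cc_infI)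
    show "C_k k (partial_deriv i \<phi>)" for k
      using K(1)[of "Suc k"] by simp
    show "partial_deriv i \<phi> x = 0" if "x \<notin> K" for x
      by (rule partial_deriv_outside[OF compact_imp_closed[OF K(2)] K(4) that])
  qed (rule K)+
qed

lemma Cc_inf_bounded_linear:
  assumes "bounded_linear T" "\<phi> \<in> Cc_inf \<Omega>" shows "(\<lambda>x. T (\<phi> x)) \<in> Cc_inf \<Omega>"
  using assms(2)
proof (rule Cc_infE)
  fix K assume K: "\<And>k. C_k k \<phi>" "compact K" "K \<subseteq> \<Omega>" "\<And>x. x \<notin> K \<Longrightarrow> \<phi> x = 0"
  show ?thesis
  proof (rule Cc_infI)
    show "T (\<phi> x) = 0" if "x \<notin> K" for x
      using K(4)[OF that] linear_0[OF bounded_linear.linear[OF assms(1)]] by simp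
  qed (rule K C_k_bounded_linear[OF assms(1)])+
qed

lemma Cc_inf_add:
  assumes "\<phi> \<in> Cc_inf \<Omega>" "\<psi> \<in> Cc_inf \<Omega>" shows "(\<lambda>x. \<phi> x + \<psi> x) \<in> Cc_inf \<Omega>"
proof -
  from assms(1) obtain K where K: "\<And>k. C_k k \<phi>" "compact K" "K \<subseteq> \<Omega>" "\<And>x. x \<notin> K \<Longrightarrow> \<phi> x = 0"
    by (rule Cc_infE) blast
  from assms(2) obtain L where L: "\<And>k. C_k k \<psi>" "compact L" "L \<subseteq> \<Omega>" "\<And>x. x \<notin> L \<Longrightarrow> \<psi> x = 0"
    by (rule Cc_infE) blast
  show ?thesis
  proof (rule Cc_infI)
    show "C_k k (\<lambda>x. \<phi> x + \<psi> x)" for k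
      by (intro C_k_add K(1) L(1))
    show "compact (K \<union> L)" "K \<union> L \<subseteq> \<Omega>"
      using K(2,3) L(2,3) by auto
    show "\<phi> x + \<psi> x = 0" if "x \<notin> K \<union> L" for x
      using K(4)[of x] L(4)[of x] that by simp
  qed
qed

lemma Cc_inf_scaleR: "\<phi> \<in> Cc_inf \<Omega> \<Longrightarrow> (\<lambda>x. c *\<^sub>R \<phi> x) \<in> Cc_inf \<Omega>"
  by (rule Cc_inf_bounded_linear) (auto intro: bounded_linear_intros)

lemma Cc_inf_diff:
  assumes "\<phi> \<in> Cc_inf \<Omega>" "\<psi> \<in> Cc_inf \<Omega>" shows "(\<lambda>x. \<phi> x - \<psi> x) \<in> Cc_inf \<Omega>"
  using Cc_inf_add[OF assms(1) Cc_inf_scaleR[OF assms(2), of "-1"]] by simp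

lemma Cc_inf_sum: "(\<And>i. i \<in> I \<Longrightarrow> \<phi> i \<in> Cc_inf \<Omega>) \<Longrightarrow> (\<lambda>x. \<Sum>i\<in>I. \<phi> i x) \<in> Cc_inf \<Omega>"
  by (induction I rule: infinite_finite_induct) (auto intro: Cc_inf_add Cc_inf_zero)

lemma Cc_inf_mult:
  fixes \<phi> :: "real^'n \<Rightarrow> real"
  assumes "\<And>k. C_k k f" "\<phi> \<in> Cc_inf \<Omega>" shows "(\<lambda>x. f x * \<phi> x) \<in> Cc_inf \<Omega>"
  using assms(2)
proof (rule Cc_infE)
  fix K assume K: "\<And>k. C_k k \<phi>" "compact K" "K \<subseteq> \<Omega>" "\<And>x. x \<notin> K \<Longrightarrow> \<phi> x = 0"
  show ?thesis
  proof (rule Cc_infI)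
    show "f x * \<phi> x = 0" if "x \<notin> K" for x
      using K(4)[OF that] by simp
  qed (rule K C_k_mult assms(1))+
qed

definition grad :: "(real^'n \<Rightarrow> real) \<Rightarrow> real^'n \<Rightarrow> real^'n" where
  "grad \<phi> x = (\<chi> i. partial_deriv i \<phi> x)"

lemma grad_nth [simp]: "grad \<phi> x $ i = partial_deriv i \<phi> x"
  by (simp add: grad_def)

lemma Cc_inf_grad:
  assumes "\<phi> \<in> Cc_inf \<Omega>" shows "grad \<phi> \<in> Cc_inf \<Omega>"
proof -
  have "grad \<phi> = (\<lambda>x. \<Sum>i\<in>UNIV. partial_deriv i \<phi> x *\<^sub>R axis i 1)"
    by (auto simp: fun_eq_iff vec_eq_iff axis_def if_distrib cong: if_cong)
  also have "\<dots> \<in> Cc_inf \<Omega>"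
    by (intro Cc_inf_sum Cc_inf_bounded_linear[of "\<lambda>t. t *\<^sub>R axis _ 1"] bounded_linear_scaleR_left
        Cc_inf_partial_deriv assms)
  finally show ?thesis .
qed

section \<open>Integration by parts\<close>

lemma integrable_continuous_compact_support:
  fixes f :: "'a::euclidean_space \<Rightarrow> real"
  assumes "continuous_on UNIV f" "compact K" "\<And>x. x \<notin> K \<Longrightarrow> f x = 0"
  shows "integrable lborel f"
proof -
  have "integrable lborel (\<lambda>x. indicator K x *\<^sub>R f x)"
    by (rule borel_integrable_compact[OF assms(2) continuous_on_subset[OF assms(1)]]) simp
  also have "(\<lambda>x. indicator K x *\<^sub>R f x) = f"
    using assms(3) by (auto simp: indicator_def fun_eq_iff)
  finally show ?thesis .
qed

text \<open>The integral of a difference quotient vanishes by translation invariance of Lebesgue measure.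
  The mean value theorem bounds the quotients by \<open>sup \<bar>\<partial>\<^sub>i f\<bar>\<close> on one fixed ball, so dominated
  convergence carries the identity over to the derivative.\<close>

lemma integral_partial_deriv_eq_0:
  fixes f :: "real^'n \<Rightarrow> real"
  assumes df: "\<forall>x. f differentiable (at x)" and cont: "continuous_on UNIV (partial_deriv i f)"
    and K: "compact K" and zero: "\<And>x. x \<notin> K \<Longrightarrow> f x = 0"
  shows "(\<integral>x. partial_deriv i f x \<partial>lborel) = 0"
proof -
  let ?e = "axis i 1 :: real^'n"
  define h where "h k = 1 / real (Suc k)" for k
  have h: "0 < h k" "h k \<le> 1" for k by (simp_all add: h_def)
  define q where "q k x = (f (x + h k *\<^sub>R ?e) - f x) / h k" for k x
  have pzero: "partial_deriv i f x = 0" if "x \<notin> K" for x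
    by (rule partial_deriv_outside[OF compact_imp_closed[OF K] zero that])
  have "\<exists>R. \<forall>x\<in>K. norm x \<le> R"
    using compact_imp_bounded[OF K] by (simp add: bounded_iff)
  then obtain R where R: "\<And>x. x \<in> K \<Longrightarrow> norm x \<le> R" by blast
  have "bounded (partial_deriv i f ` K)"
    by (intro compact_imp_bounded compact_continuous_image[OF continuous_on_subset[OF cont] K]) simp
  then obtain B where B: "\<And>y. y \<in> partial_deriv i f ` K \<Longrightarrow> norm y \<le> B" "B > 0"
    unfolding bounded_pos by blast
  have bound: "\<bar>partial_deriv i f x\<bar> \<le> B" for x
    using B(1)[of "partial_deriv i f x"] B(2) pzero by (cases "x \<in> K") auto
  have fcont: "continuous_on UNIV f"
    using df by (meson continuous_at_imp_continuous_on differentiable_imp_continuous_within)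
  have fint: "integrable lborel f"
    by (rule integrable_continuous_compact_support[OF fcont K zero])
  have meas[measurable]: "f \<in> borel_measurable borel" "partial_deriv i f \<in> borel_measurable borel"
    using fcont cont by (auto intro: borel_measurable_continuous_onI)
  have shift: "integrable lborel (\<lambda>x. f (x + v))" "(\<integral>x. f (x + v) \<partial>lborel) = (\<integral>x. f x \<partial>lborel)" for v
  proof -
    have *: "lborel = distr lborel borel ((+) v)" by (simp add: lborel_distr_plus)
    show "integrable lborel (\<lambda>x. f (x + v))"
      using fint integrable_distr_eq[of "(+) v" lborel borel f]
      by (simp add: lborel_distr_plus add.commute)
    show "(\<integral>x. f (x + v) \<partial>lborel) = (\<integral>x. f x \<partial>lborel)"
      using integral_distr[of "(+) v" lborel borel f]
      by (simp add: lborel_distr_plus add.commute)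
  qed
  have q0: "(\<integral>x. q k x \<partial>lborel) = 0" for k
    unfolding q_def using shift fint by simp
  have qbound: "\<bar>q k x\<bar> \<le> B * indicator (cball 0 (R + 1)) x" for k x
  proof (cases "x \<in> cball 0 (R + 1)")
    case True
    have "\<exists>s. 0 < s \<and> s < h k \<and> f (x + h k *\<^sub>R ?e) - f (x + 0 *\<^sub>R ?e)
        = (h k - 0) * partial_deriv i f (x + s *\<^sub>R ?e)"
      by (rule MVT2[OF h(1)]) (rule has_real_derivative_along_axis[OF df])
    then obtain s where "f (x + h k *\<^sub>R ?e) - f x = h k * partial_deriv i f (x + s *\<^sub>R ?e)"
      by auto
    then have "q k x = partial_deriv i f (x + s *\<^sub>R ?e)"
      using h(1)[of k] by (simp add: q_def)
    then show ?thesis using bound True by simp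
  next
    case False
    have "norm (h k *\<^sub>R ?e) \<le> 1" using h[of k] by simp
    moreover have "norm x \<le> norm (x + h k *\<^sub>R ?e) + norm (h k *\<^sub>R ?e)"
      using norm_triangle_ineq4[of "x + h k *\<^sub>R ?e" "h k *\<^sub>R ?e"] by simp
    ultimately have "x \<notin> K" "x + h k *\<^sub>R ?e \<notin> K"
      using False R[of x] R[of "x + h k *\<^sub>R ?e"] by force+
    then show ?thesis using False zero by (simp add: q_def)
  qed
  have lim: "(\<lambda>k. q k x) \<longlonglongrightarrow> partial_deriv i f x" for x
  proof -
    have "((\<lambda>s. f (x + s *\<^sub>R ?e)) has_real_derivative partial_deriv i f (x + 0 *\<^sub>R ?e)) (at 0)"
      by (rule has_real_derivative_along_axis[OF df])
    then have "((\<lambda>t. (f (x + t *\<^sub>R ?e) - f x) / t) \<longlongrightarrow> partial_deriv i f x) (at 0)"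
      by (simp add: DERIV_def)
    moreover have "filterlim h (at 0) sequentially"
      unfolding h_def filterlim_at
      using LIMSEQ_inverse_real_of_nat by (auto simp: inverse_eq_divide)
    ultimately show ?thesis
      unfolding q_def by (rule filterlim_compose)
  qed
  have "(\<lambda>k. \<integral>x. q k x \<partial>lborel) \<longlonglongrightarrow> (\<integral>x. partial_deriv i f x \<partial>lborel)"
  proof (rule integral_dominated_convergence)
    show "integrable lborel (\<lambda>x. B * indicator (cball 0 (R + 1)) x :: real)"
      by (intro integrable_mult_right integrable_real_indicator) (simp_all add: emeasure_bounded_finite[OF bounded_cball, simplified])
    show "q k \<in> borel_measurable lborel" for k
      unfolding q_def by measurable
  qed (use lim qbound in auto)
  then show ?thesis
    by (simp add: q0 LIMSEQ_const_iff)
qed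

lemma integral_lebesgue_on_compact_support:
  fixes g :: "'a::euclidean_space \<Rightarrow> real"
  assumes "\<Omega> \<in> sets lebesgue" "g \<in> borel_measurable borel" "K \<subseteq> \<Omega>" "\<And>x. x \<notin> K \<Longrightarrow> g x = 0"
  shows "(\<integral>x. g x \<partial>(lebesgue_on \<Omega>)) = (\<integral>x. g x \<partial>lborel)"
    and "integrable (lebesgue_on \<Omega>) g \<longleftrightarrow> integrable lborel g"
proof -
  have eq: "(\<lambda>x. if x \<in> \<Omega> then g x else 0) = g"
    using assms(3,4) by (auto simp: fun_eq_iff)
  show "(\<integral>x. g x \<partial>(lebesgue_on \<Omega>)) = (\<integral>x. g x \<partial>lborel)"
    using Lebesgue_Measure.integral_restrict_UNIV[OF assms(1), of g] integral_completion[of g lborel] assms(2)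
    by (simp add: eq)
  show "integrable (lebesgue_on \<Omega>) g \<longleftrightarrow> integrable lborel g"
    using Lebesgue_Measure.integrable_restrict_UNIV[OF assms(1), of g] integrable_completion[of g lborel] assms(2)
    by (simp add: eq)
qed

lemma Cc_inf_integrable:
  fixes \<phi> :: "real^'n \<Rightarrow> real"
  assumes "\<Omega> \<in> sets lebesgue" "\<phi> \<in> Cc_inf \<Omega>"
  shows "integrable (lebesgue_on \<Omega>) \<phi>"
  using assms(2)
proof (rule Cc_infE)
  fix K assume K: "compact K" "K \<subseteq> \<Omega>" "\<And>x. x \<notin> K \<Longrightarrow> \<phi> x = 0"
  have "continuous_on UNIV \<phi>" by (rule Cc_inf_continuous[OF assms(2)])
  then show ?thesis
    using integral_lebesgue_on_compact_support(2)[OF assms(1) borel_measurable_continuous_onI K(2,3)]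
      integrable_continuous_compact_support[OF _ K(1,3)] by simp
qed

lemma Cc_inf_integral_partial_deriv:
  fixes \<phi> :: "real^'n \<Rightarrow> real"
  assumes "\<Omega> \<in> sets lebesgue" "\<phi> \<in> Cc_inf \<Omega>"
  shows "(\<integral>x. partial_deriv i \<phi> x \<partial>(lebesgue_on \<Omega>)) = 0"
  using assms(2)
proof (rule Cc_infE)
  fix K assume K: "compact K" "K \<subseteq> \<Omega>" "\<And>x. x \<notin> K \<Longrightarrow> \<phi> x = 0"
  have cont: "continuous_on UNIV (partial_deriv i \<phi>)"
    by (rule Cc_inf_continuous[OF Cc_inf_partial_deriv[OF assms(2)]])
  have "(\<integral>x. partial_deriv i \<phi> x \<partial>(lebesgue_on \<Omega>)) = (\<integral>x. partial_deriv i \<phi> x \<partial>lborel)"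
    by (rule integral_lebesgue_on_compact_support(1)[OF assms(1) borel_measurable_continuous_onI[OF cont] K(2)
      partial_deriv_outside[OF compact_imp_closed[OF K(1)] K(3)]])
  also have "\<dots> = 0"
    by (rule integral_partial_deriv_eq_0[OF Cc_inf_differentiable[OF assms(2)] cont K(1,3)])
  finally show ?thesis .
qed

lemma integration_by_parts:
  fixes u \<phi> :: "real^'n \<Rightarrow> real"
  assumes "\<Omega> \<in> sets lebesgue" "\<And>k. C_k k u" "\<phi> \<in> Cc_inf \<Omega>"
  shows "(\<integral>x. u x * partial_deriv i \<phi> x \<partial>(lebesgue_on \<Omega>)) =
    - (\<integral>x. partial_deriv i u x * \<phi> x \<partial>(lebesgue_on \<Omega>))"
proof -
  have du: "\<forall>x. u differentiable (at x)" and pu: "C_k k (partial_deriv i u)" for k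
    using assms(2)[of "Suc k" for k] by simp_all
  have "0 = (\<integral>x. partial_deriv i (\<lambda>x. u x * \<phi> x) x \<partial>(lebesgue_on \<Omega>))"
    by (simp add: Cc_inf_integral_partial_deriv Cc_inf_mult assms)
  also have "\<dots> = (\<integral>x. u x * partial_deriv i \<phi> x + partial_deriv i u x * \<phi> x \<partial>(lebesgue_on \<Omega>))"
    by (simp add: partial_deriv_mult[OF du Cc_inf_differentiable[OF assms(3)]])
  also have "\<dots> = (\<integral>x. u x * partial_deriv i \<phi> x \<partial>(lebesgue_on \<Omega>)) +
      (\<integral>x. partial_deriv i u x * \<phi> x \<partial>(lebesgue_on \<Omega>))"
    by (intro Bochner_Integration.integral_add Cc_inf_integrable Cc_inf_mult Cc_inf_partial_deriv assms pu)
  finally show ?thesis by simp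
qed

section \<open>Square-integrable fields\<close>

definition L2_inner :: "(real^'n) set \<Rightarrow> (real^'n \<Rightarrow> 'b::euclidean_space) \<Rightarrow> (real^'n \<Rightarrow> 'b) \<Rightarrow> real" where
  "L2_inner \<Omega> f g = (\<integral>x. f x \<bullet> g x \<partial>(lebesgue_on \<Omega>))"

lemma L2_measurable: "f \<in> L2 \<Omega> \<Longrightarrow> f \<in> borel_measurable (lebesgue_on \<Omega>)"
  by (simp add: L2_def)

lemma L2_inner_integrable:
  assumes "f \<in> L2 \<Omega>" "g \<in> L2 \<Omega>"
  shows "integrable (lebesgue_on \<Omega>) (\<lambda>x. f x \<bullet> g x)"
proof (rule Bochner_Integration.integrable_bound)
  show "integrable (lebesgue_on \<Omega>) (\<lambda>x. (norm (f x))\<^sup>2 + (norm (g x))\<^sup>2)"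
    using assms by (simp add: L2_def)
  show "(\<lambda>x. f x \<bullet> g x) \<in> borel_measurable (lebesgue_on \<Omega>)"
    using assms by (auto simp: L2_def)
  have "norm (a \<bullet> b) \<le> norm ((norm a)\<^sup>2 + (norm b)\<^sup>2)" for a b :: 'b
  proof -
    have "2 * (norm a * norm b) \<le> (norm a)\<^sup>2 + (norm b)\<^sup>2"
      using sum_squares_bound[of "norm a" "norm b"] by (simp add: mult.assoc)
    moreover have "0 \<le> norm a * norm b" by simp
    ultimately show ?thesis
      using Cauchy_Schwarz_ineq2[of a b] by simp
  qed
  then show "AE x in lebesgue_on \<Omega>. norm (f x \<bullet> g x) \<le> norm ((norm (f x))\<^sup>2 + (norm (g x))\<^sup>2)"
    by blast
qed

lemma L2I:
  assumes "f \<in> borel_measurable (lebesgue_on \<Omega>)" "integrable (lebesgue_on \<Omega>) g"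
    "\<And>x. (norm (f x))\<^sup>2 \<le> g x"
  shows "f \<in> L2 \<Omega>"
proof -
  have "(norm (f x))\<^sup>2 \<le> \<bar>g x\<bar>" for x
    using assms(3)[of x] by linarith
  then show ?thesis
    using assms(1) by (auto simp: L2_def intro!: Bochner_Integration.integrable_bound[OF assms(2)])
qed

lemma L2_scaleR: "f \<in> L2 \<Omega> \<Longrightarrow> (\<lambda>x. c *\<^sub>R f x) \<in> L2 \<Omega>"
  by (auto simp: L2_def power_mult_distrib)

lemma L2_add:
  assumes "f \<in> L2 \<Omega>" "g \<in> L2 \<Omega>" shows "(\<lambda>x. f x + g x) \<in> L2 \<Omega>"
proof (rule L2I)
  show "integrable (lebesgue_on \<Omega>) (\<lambda>x. (norm (f x))\<^sup>2 + (norm (g x))\<^sup>2 + 2 * (f x \<bullet> g x))"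
    using assms L2_inner_integrable[OF assms] by (simp add: L2_def)
  show "(\<lambda>x. f x + g x) \<in> borel_measurable (lebesgue_on \<Omega>)"
    using assms by (auto simp: L2_def)
  show "(norm (f x + g x))\<^sup>2 \<le> (norm (f x))\<^sup>2 + (norm (g x))\<^sup>2 + 2 * (f x \<bullet> g x)" for x
    by (simp add: power2_norm_eq_inner inner_simps inner_commute)
qed

lemma L2_diff: "f \<in> L2 \<Omega> \<Longrightarrow> g \<in> L2 \<Omega> \<Longrightarrow> (\<lambda>x. f x - g x) \<in> L2 \<Omega>"
  using L2_add[of f \<Omega> "\<lambda>x. (-1) *\<^sub>R g x"] L2_scaleR[of g \<Omega> "-1"] by simp

lemma L2_zero: "(\<lambda>x. 0) \<in> L2 \<Omega>"
  by (simp add: L2_def)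

lemma L2_inner_diff_left:
  "f \<in> L2 \<Omega> \<Longrightarrow> g \<in> L2 \<Omega> \<Longrightarrow> h \<in> L2 \<Omega> \<Longrightarrow>
    L2_inner \<Omega> (\<lambda>x. f x - g x) h = L2_inner \<Omega> f h - L2_inner \<Omega> g h"
  by (simp add: L2_inner_def inner_diff_left L2_inner_integrable)

lemma L2_norm_nonneg [simp]: "0 \<le> L2_norm \<Omega> f"
  by (simp add: L2_norm_def)

lemma L2_norm_power2: "(L2_norm \<Omega> f)\<^sup>2 = L2_inner \<Omega> f f"
  by (simp add: L2_norm_def L2_inner_def power2_norm_eq_inner)

lemma L2_norm_zero [simp]: "L2_norm \<Omega> (\<lambda>x. 0) = 0"
  by (simp add: L2_norm_def)

lemma L2_norm_scaleR: "L2_norm \<Omega> (\<lambda>x. c *\<^sub>R f x) = \<bar>c\<bar> * L2_norm \<Omega> f"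
  by (simp add: L2_norm_def power_mult_distrib real_sqrt_mult)

lemma L2_norm_minus_commute: "L2_norm \<Omega> (\<lambda>x. f x - g x) = L2_norm \<Omega> (\<lambda>x. g x - f x)"
  by (simp add: L2_norm_def norm_minus_commute)

lemma L2_norm_add_scaleR_power2:
  assumes "f \<in> L2 \<Omega>" "g \<in> L2 \<Omega>"
  shows "(L2_norm \<Omega> (\<lambda>x. f x + c *\<^sub>R g x))\<^sup>2 =
    (L2_norm \<Omega> f)\<^sup>2 + 2 * c * L2_inner \<Omega> f g + c\<^sup>2 * (L2_norm \<Omega> g)\<^sup>2"
proof -
  have "(f x + c *\<^sub>R g x) \<bullet> (f x + c *\<^sub>R g x) =
      f x \<bullet> f x + 2 * c * (f x \<bullet> g x) + c\<^sup>2 * (g x \<bullet> g x)" for x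
    by (simp add: inner_add_left inner_add_right inner_commute[of "g x" "f x"] power2_eq_square algebra_simps)
  then show ?thesis
    using L2_inner_integrable[OF assms(1,1)] L2_inner_integrable[OF assms] L2_inner_integrable[OF assms(2,2)]
    unfolding L2_norm_power2 L2_inner_def by simp
qed

text \<open>Used with \<open>a = \<parallel>g\<parallel>\<^sup>2\<close>, \<open>b = \<langle>f, g\<rangle>\<close>: with \<open>c = \<parallel>f\<parallel>\<^sup>2\<close> it is the Cauchy-Schwarz inequality, and with \<open>c = 0\<close>
  it is the orthogonality relation satisfied at a minimum of a squared distance.\<close>

lemma nonneg_quadratic_discriminant:
  fixes a b c :: real
  assumes "0 \<le> a" and pos: "\<And>t. 0 \<le> c + 2 * t * b + t\<^sup>2 * a"
  shows "b\<^sup>2 \<le> a * c"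
proof (cases "a = 0")
  case True
  have "b = 0"
  proof (rule ccontr)
    assume "b \<noteq> 0"
    then have "2 * (- (c + 1) / (2 * b)) * b = - (c + 1)" by simp
    then show False using pos[of "- (c + 1) / (2 * b)"] True by simp
  qed
  with True show ?thesis by simp
next
  case False
  with assms(1) have "a > 0" by simp
  then have "c + 2 * (- b / a) * b + (- b / a)\<^sup>2 * a = c - b\<^sup>2 / a"
    by (simp add: power2_eq_square field_simps)
  with pos[of "- b / a"] have "0 \<le> c - b\<^sup>2 / a" by simp
  with \<open>a > 0\<close> show ?thesis by (simp add: field_simps)
qed

lemma L2_Cauchy_Schwarz:
  assumes "f \<in> L2 \<Omega>" "g \<in> L2 \<Omega>"
  shows "\<bar>L2_inner \<Omega> f g\<bar> \<le> L2_norm \<Omega> f * L2_norm \<Omega> g"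
proof -
  have "(L2_inner \<Omega> f g)\<^sup>2 \<le> (L2_norm \<Omega> g)\<^sup>2 * (L2_norm \<Omega> f)\<^sup>2"
  proof (rule nonneg_quadratic_discriminant)
    show "0 \<le> (L2_norm \<Omega> f)\<^sup>2 + 2 * t * L2_inner \<Omega> f g + t\<^sup>2 * (L2_norm \<Omega> g)\<^sup>2" for t
      unfolding L2_norm_add_scaleR_power2[OF assms, symmetric] by simp
  qed simp
  then have "\<bar>L2_inner \<Omega> f g\<bar>\<^sup>2 \<le> (L2_norm \<Omega> f * L2_norm \<Omega> g)\<^sup>2"
    by (simp add: power_mult_distrib mult.commute)
  then show ?thesis
    by (rule power2_le_imp_le) simp
qed

lemma L2_triangle:
  assumes "f \<in> L2 \<Omega>" "g \<in> L2 \<Omega>"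
  shows "L2_norm \<Omega> (\<lambda>x. f x + g x) \<le> L2_norm \<Omega> f + L2_norm \<Omega> g"
proof (rule power2_le_imp_le)
  show "(L2_norm \<Omega> (\<lambda>x. f x + g x))\<^sup>2 \<le> (L2_norm \<Omega> f + L2_norm \<Omega> g)\<^sup>2"
    using L2_norm_add_scaleR_power2[OF assms, of 1] L2_Cauchy_Schwarz[OF assms]
    by (simp add: power2_sum)
qed simp

lemma L2_norm_cong_AE:
  assumes "f \<in> L2 \<Omega>" "g \<in> L2 \<Omega>" "AE x in lebesgue_on \<Omega>. f x = g x"
  shows "L2_norm \<Omega> f = L2_norm \<Omega> g"
proof -
  have "(\<integral>x. (norm (f x))\<^sup>2 \<partial>(lebesgue_on \<Omega>)) = (\<integral>x. (norm (g x))\<^sup>2 \<partial>(lebesgue_on \<Omega>))"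
    using assms by (intro integral_cong_AE) (auto simp: L2_def)
  then show ?thesis by (simp add: L2_norm_def)
qed

lemma L2_norm_eq_0_AE:
  assumes "f \<in> L2 \<Omega>" "L2_norm \<Omega> f = 0"
  shows "AE x in lebesgue_on \<Omega>. f x = 0"
proof -
  have "(\<integral>x. (norm (f x))\<^sup>2 \<partial>(lebesgue_on \<Omega>)) = 0"
    using assms(2) by (simp add: L2_norm_def)
  then have "AE x in lebesgue_on \<Omega>. (norm (f x))\<^sup>2 = 0"
    using assms(1) by (subst (asm) integral_nonneg_eq_0_iff_AE) (auto simp: L2_def)
  then show ?thesis by simp
qed

lemma Cc_inf_L2:
  fixes \<phi> :: "real^'n \<Rightarrow> 'b::euclidean_space"
  assumes "\<Omega> \<in> sets lebesgue" "\<phi> \<in> Cc_inf \<Omega>"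
  shows "\<phi> \<in> L2 \<Omega>"
  using assms(2)
proof (rule Cc_infE)
  fix K assume K: "compact K" "K \<subseteq> \<Omega>" "\<And>x. x \<notin> K \<Longrightarrow> \<phi> x = 0"
  have cont: "continuous_on UNIV \<phi>" by (rule Cc_inf_continuous[OF assms(2)])
  then have cont2: "continuous_on UNIV (\<lambda>x. (norm (\<phi> x))\<^sup>2)"
    by (intro continuous_intros)
  have "integrable (lebesgue_on \<Omega>) (\<lambda>x. (norm (\<phi> x))\<^sup>2)"
    using integral_lebesgue_on_compact_support(2)[OF assms(1) borel_measurable_continuous_onI[OF cont2] K(2)]
      integrable_continuous_compact_support[OF cont2 K(1)] K(3) by simp
  moreover have "\<phi> \<in> borel_measurable (lebesgue_on \<Omega>)"
    by (intro measurable_restrict_space1 measurable_completion)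
       (use borel_measurable_continuous_onI[OF cont] in simp)
  ultimately show ?thesis by (simp add: L2_def)
qed

lemma L2_integral_norm_le:
  assumes "\<Omega> \<in> lmeasurable" "f \<in> L2 \<Omega>"
  shows "integrable (lebesgue_on \<Omega>) (\<lambda>x. norm (f x))"
    and "(\<integral>x. norm (f x) \<partial>(lebesgue_on \<Omega>)) \<le> L2_norm \<Omega> (\<lambda>x. 1::real) * L2_norm \<Omega> f"
proof -
  interpret finite_measure "lebesgue_on \<Omega>"
    by (rule finite_measure_lebesgue_on[OF assms(1)])
  have one: "(\<lambda>x. 1::real) \<in> L2 \<Omega>" by (simp add: L2_def)
  have nf: "(\<lambda>x. norm (f x)) \<in> L2 \<Omega>"
    using assms(2) by (auto simp: L2_def)
  show "integrable (lebesgue_on \<Omega>) (\<lambda>x. norm (f x))"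
    using L2_inner_integrable[OF one nf] by simp
  have "L2_norm \<Omega> (\<lambda>x. norm (f x)) = L2_norm \<Omega> f" by (simp add: L2_norm_def)
  then show "(\<integral>x. norm (f x) \<partial>(lebesgue_on \<Omega>)) \<le> L2_norm \<Omega> (\<lambda>x. 1::real) * L2_norm \<Omega> f"
    using L2_Cauchy_Schwarz[OF one nf] by (simp add: L2_inner_def)
qed

text \<open>On a set of finite measure the \<open>L\<^sup>1\<close> norm is controlled by the \<open>L\<^sup>2\<close> norm. A subsequence with
  rapidly decreasing increments therefore has an almost everywhere absolutely convergent
  telescoping series; Fatou's lemma, applied to \<open>\<bar>f n - f (r k)\<bar>\<^sup>2\<close> as \<open>k\<close> grows, shows that its
  pointwise limit is also the \<open>L\<^sup>2\<close> limit of the whole sequence.\<close>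

lemma L2_complete:
  fixes f :: "nat \<Rightarrow> real^'n \<Rightarrow> 'b::euclidean_space"
  assumes \<Omega>: "\<Omega> \<in> lmeasurable" and f: "\<And>n. f n \<in> L2 \<Omega>"
    and Cauchy: "\<And>e. e > 0 \<Longrightarrow> \<exists>N. \<forall>m\<ge>N. \<forall>n\<ge>N. L2_norm \<Omega> (\<lambda>x. f m x - f n x) < e"
  shows "\<exists>g\<in>L2 \<Omega>. (\<lambda>n. L2_norm \<Omega> (\<lambda>x. f n x - g x)) \<longlonglongrightarrow> 0"
proof -
  let ?M = "lebesgue_on \<Omega>"
  have meas[measurable]: "f n \<in> borel_measurable ?M" for n
    using f by (rule L2_measurable)
  have "\<exists>N. \<forall>m\<ge>N. \<forall>n\<ge>N. L2_norm \<Omega> (\<lambda>x. f m x - f n x) < (1/2)^k" for k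
    by (rule Cauchy) simp
  then obtain N where N: "\<And>k m n. m \<ge> N k \<Longrightarrow> n \<ge> N k \<Longrightarrow> L2_norm \<Omega> (\<lambda>x. f m x - f n x) < (1/2)^k"
    by metis
  \<comment> \<open>The summand \<open>k\<close> makes \<open>r\<close> strictly increasing even where the thresholds \<open>N i\<close> vanish.\<close>
  define r where "r k = (\<Sum>i\<le>k. N i) + k" for k
  have rN: "r k \<ge> N k" for k
    using member_le_sum[of k "{..k}" N] by (simp add: r_def)
  have rmono: "strict_mono r"
    by (simp add: strict_mono_Suc_iff r_def)
  define d where "d k x = f (r (Suc k)) x - f (r k) x" for k x
  have d: "d k \<in> L2 \<Omega>" for k
    unfolding d_def by (intro L2_diff f)
  have dmeas[measurable]: "d k \<in> borel_measurable ?M" for k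
    unfolding d_def by measurable
  have "L2_norm \<Omega> (d k) \<le> (1/2)^k" for k
    unfolding d_def using N[of k "r (Suc k)" "r k"] rN[of k] strict_monoD[OF rmono, of k "Suc k"]
    by (simp add: less_imp_le)
  then have dint: "(\<integral>x. norm (d k x) \<partial>?M) \<le> L2_norm \<Omega> (\<lambda>x. 1::real) * (1/2)^k" for k
    using L2_integral_norm_le(2)[OF \<Omega> d] by (meson L2_norm_nonneg mult_left_mono order_trans)
  have "(\<integral>\<^sup>+x. (\<Sum>k. ennreal (norm (d k x))) \<partial>?M) = (\<Sum>k. \<integral>\<^sup>+x. ennreal (norm (d k x)) \<partial>?M)"
    by (rule nn_integral_suminf) measurable
  also have "\<dots> = (\<Sum>k. ennreal (\<integral>x. norm (d k x) \<partial>?M))"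
    by (simp add: nn_integral_eq_integral L2_integral_norm_le(1)[OF \<Omega> d])
  also have "\<dots> \<noteq> \<infinity>"
  proof -
    have "summable (\<lambda>k. L2_norm \<Omega> (\<lambda>x. 1::real) * (1/2)^k)"
      by (intro summable_mult summable_geometric) simp
    then have "summable (\<lambda>k. \<integral>x. norm (d k x) \<partial>?M)"
      by (rule summable_comparison_test'[of _ 0]) (use dint in simp)
    then show ?thesis
      unfolding infinity_ennreal_def by (rule ennreal_suminf_neq_top) simp
  qed
  finally have "AE x in ?M. (\<Sum>k. ennreal (norm (d k x))) \<noteq> \<infinity>"
    by (intro nn_integral_PInf_AE) measurable
  then have conv: "AE x in ?M. convergent (\<lambda>k. f (r k) x)"
  proof eventually_elim
    case (elim x)
    then have "summable (\<lambda>k. norm (d k x))"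
      by (intro summable_suminf_not_top) auto
    then have "summable (\<lambda>k. d k x)"
      by (rule summable_norm_cancel)
    then have "convergent (\<lambda>n. f (r n) x - f (r 0) x)"
      by (simp add: summable_iff_convergent d_def sum_lessThan_telescope[of "\<lambda>n. f (r n) x"])
    then have "convergent (\<lambda>n. f (r n) x - f (r 0) x + f (r 0) x)"
      by (intro convergent_add convergent_const)
    then show ?case by simp
  qed
  define g where "g x = lim (\<lambda>k. f (r k) x)" for x
  have g[measurable]: "g \<in> borel_measurable ?M"
    unfolding g_def by measurable
  have fatou: "(\<integral>\<^sup>+x. ennreal ((norm (f n x - g x))\<^sup>2) \<partial>?M) \<le> ennreal (e\<^sup>2)"
    if "e > 0" and n: "\<And>m. m \<ge> n \<Longrightarrow> L2_norm \<Omega> (\<lambda>x. f n x - f m x) \<le> e" for n e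
  proof -
    have "(\<integral>\<^sup>+x. ennreal ((norm (f n x - g x))\<^sup>2) \<partial>?M) =
        (\<integral>\<^sup>+x. liminf (\<lambda>k. ennreal ((norm (f n x - f (r k) x))\<^sup>2)) \<partial>?M)"
    proof (rule nn_integral_cong_AE)
      show "AE x in ?M. ennreal ((norm (f n x - g x))\<^sup>2) =
          liminf (\<lambda>k. ennreal ((norm (f n x - f (r k) x))\<^sup>2))"
        using conv
      proof eventually_elim
        case (elim x)
        then have "(\<lambda>k. f (r k) x) \<longlonglongrightarrow> g x"
          by (simp add: g_def convergent_LIMSEQ_iff)
        then have "(\<lambda>k. ennreal ((norm (f n x - f (r k) x))\<^sup>2)) \<longlonglongrightarrow> ennreal ((norm (f n x - g x))\<^sup>2)"
          by (intro tendsto_ennrealI tendsto_intros)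
        then show ?case
          by (rule lim_imp_Liminf[OF trivial_limit_sequentially, symmetric])
      qed
    qed
    also have "\<dots> \<le> liminf (\<lambda>k. \<integral>\<^sup>+x. ennreal ((norm (f n x - f (r k) x))\<^sup>2) \<partial>?M)"
      by (rule nn_integral_liminf) measurable
    also have "\<dots> \<le> ennreal (e\<^sup>2)"
    proof -
      have "(\<integral>\<^sup>+x. ennreal ((norm (f n x - f (r k) x))\<^sup>2) \<partial>?M) \<le> ennreal (e\<^sup>2)" if "k \<ge> n" for k
      proof -
        have "(\<lambda>x. f n x - f (r k) x) \<in> L2 \<Omega>" by (intro L2_diff f)
        then have "(\<integral>\<^sup>+x. ennreal ((norm (f n x - f (r k) x))\<^sup>2) \<partial>?M) =
            ennreal (\<integral>x. (norm (f n x - f (r k) x))\<^sup>2 \<partial>?M)"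
          by (intro nn_integral_eq_integral) (auto simp: L2_def)
        also have "(\<integral>x. (norm (f n x - f (r k) x))\<^sup>2 \<partial>?M) = (L2_norm \<Omega> (\<lambda>x. f n x - f (r k) x))\<^sup>2"
          by (simp add: L2_norm_def)
        also have "\<dots> \<le> e\<^sup>2"
          using n[of "r k"] seq_suble[OF rmono, of k] that by (intro power_mono) auto
        finally show ?thesis by (simp add: ennreal_leI)
      qed
      then have "eventually (\<lambda>k. (\<integral>\<^sup>+x. ennreal ((norm (f n x - f (r k) x))\<^sup>2) \<partial>?M) \<le> ennreal (e\<^sup>2)) sequentially"
        by (auto simp: eventually_sequentially)
      then have "liminf (\<lambda>k. \<integral>\<^sup>+x. ennreal ((norm (f n x - f (r k) x))\<^sup>2) \<partial>?M) \<le> liminf (\<lambda>k. ennreal (e\<^sup>2))"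
        by (rule Liminf_mono)
      then show ?thesis by (simp add: Liminf_const)
    qed
    finally show ?thesis .
  qed
  have fg: "(\<lambda>x. f n x - g x) \<in> L2 \<Omega> \<and> L2_norm \<Omega> (\<lambda>x. f n x - g x) \<le> e"
    if "e > 0" and n: "\<And>m. m \<ge> n \<Longrightarrow> L2_norm \<Omega> (\<lambda>x. f n x - f m x) \<le> e" for n e
  proof
    note F = fatou[OF that]
    have int: "integrable ?M (\<lambda>x. (norm (f n x - g x))\<^sup>2)"
      using F by (intro integrableI_bounded) (auto simp: top_unique less_top[symmetric])
    then show *: "(\<lambda>x. f n x - g x) \<in> L2 \<Omega>"
      by (simp add: L2_def)
    have "ennreal ((L2_norm \<Omega> (\<lambda>x. f n x - g x))\<^sup>2) \<le> ennreal (e\<^sup>2)"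
      using F int by (simp add: nn_integral_eq_integral L2_norm_def)
    then have "(L2_norm \<Omega> (\<lambda>x. f n x - g x))\<^sup>2 \<le> e\<^sup>2" by simp
    then show "L2_norm \<Omega> (\<lambda>x. f n x - g x) \<le> e"
      by (rule power2_le_imp_le) (use that(1) in simp)
  qed
  have ev: "\<exists>N. \<forall>n\<ge>N. (\<lambda>x. f n x - g x) \<in> L2 \<Omega> \<and> L2_norm \<Omega> (\<lambda>x. f n x - g x) \<le> e" if e: "e > 0" for e
  proof -
    obtain N where "\<And>m n. m \<ge> N \<Longrightarrow> n \<ge> N \<Longrightarrow> L2_norm \<Omega> (\<lambda>x. f m x - f n x) < e"
      using Cauchy[OF e] by blast
    then show ?thesis
      by (intro exI[of _ N] allI impI fg e less_imp_le) auto
  qed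
  obtain n where "(\<lambda>x. f n x - g x) \<in> L2 \<Omega>"
    using ev[of 1] by auto
  from L2_diff[OF f[of n] this] have "g \<in> L2 \<Omega>" by simp
  moreover have "(\<lambda>n. L2_norm \<Omega> (\<lambda>x. f n x - g x)) \<longlonglongrightarrow> 0"
  proof (rule LIMSEQ_I)
    fix e :: real assume "e > 0"
    show "\<exists>no. \<forall>n\<ge>no. norm (L2_norm \<Omega> (\<lambda>x. f n x - g x) - 0) < e"
    proof -
      obtain N where N: "\<And>n. n \<ge> N \<Longrightarrow> L2_norm \<Omega> (\<lambda>x. f n x - g x) \<le> e / 2"
        using ev[of "e / 2"] \<open>e > 0\<close> by auto
      have "norm (L2_norm \<Omega> (\<lambda>x. f n x - g x) - 0) < e" if "n \<ge> N" for n
        using N[OF that] \<open>e > 0\<close> by simp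
      then show ?thesis by blast
    qed
  qed
  ultimately show ?thesis by blast
qed

lemma L2_real_mult_integrable:
  fixes f g :: "real^'n \<Rightarrow> real"
  shows "f \<in> L2 \<Omega> \<Longrightarrow> g \<in> L2 \<Omega> \<Longrightarrow> integrable (lebesgue_on \<Omega>) (\<lambda>x. f x * g x)"
  using L2_inner_integrable[of f \<Omega> g] by simp

lemma L2_nth:
  fixes f :: "real^'n \<Rightarrow> 'b::euclidean_space^'m"
  assumes "f \<in> L2 \<Omega>" shows "(\<lambda>x. f x $ i) \<in> L2 \<Omega>"
proof (rule L2I)
  show "(\<lambda>x. f x $ i) \<in> borel_measurable (lebesgue_on \<Omega>)"
    using L2_measurable[OF assms] by (rule measurable_compose) (intro borel_measurable_continuous_onI continuous_intros)
  show "integrable (lebesgue_on \<Omega>) (\<lambda>x. (norm (f x))\<^sup>2)"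
    using assms by (simp add: L2_def)
  show "(norm (f x $ i))\<^sup>2 \<le> (norm (f x))\<^sup>2" for x
    by (intro power_mono Finite_Cartesian_Product.norm_nth_le) simp
qed

lemma power2_norm_vec:
  fixes a :: "'b::real_inner^'m"
  shows "(norm a)\<^sup>2 = (\<Sum>n\<in>UNIV. (norm (a $ n))\<^sup>2)"
  by (simp add: power2_norm_eq_inner inner_vec_def)

lemma L2_vec:
  fixes f :: "real^'n \<Rightarrow> 'b::euclidean_space^'m"
  assumes "\<And>n. (\<lambda>x. f x $ n) \<in> L2 \<Omega>"
  shows "f \<in> L2 \<Omega>" and "L2_norm \<Omega> f \<le> (\<Sum>n\<in>UNIV. L2_norm \<Omega> (\<lambda>x. f x $ n))"
proof -
  have int: "integrable (lebesgue_on \<Omega>) (\<lambda>x. (norm (f x $ n))\<^sup>2)" for n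
    using assms by (simp add: L2_def)
  have "(\<lambda>x. f x \<bullet> b) \<in> borel_measurable (lebesgue_on \<Omega>)" if b: "b \<in> Basis" for b
  proof -
    obtain n u where "b = axis n u" using b by (auto simp: Basis_vec_def)
    then show ?thesis
      using L2_measurable[OF assms[of n]] by (simp add: inner_axis)
  qed
  then have "f \<in> borel_measurable (lebesgue_on \<Omega>)"
    by (rule borel_measurable_euclidean_space[THEN iffD2, rule_format])
  then show "f \<in> L2 \<Omega>"
    using int by (simp add: L2_def power2_norm_vec[of "f _"])
  have "L2_norm \<Omega> f = L2_set (\<lambda>n. L2_norm \<Omega> (\<lambda>x. f x $ n)) UNIV"
    using int by (simp add: L2_norm_def L2_set_def power2_norm_vec[of "f _"])
  then show "L2_norm \<Omega> f \<le> (\<Sum>n\<in>UNIV. L2_norm \<Omega> (\<lambda>x. f x $ n))"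
    by (simp add: L2_set_le_sum)
qed

lemma L2_norm_mono:
  assumes "f \<in> L2 \<Omega>" "g \<in> L2 \<Omega>" "\<And>x. x \<in> \<Omega> \<Longrightarrow> norm (f x) \<le> norm (g x)"
  shows "L2_norm \<Omega> f \<le> L2_norm \<Omega> g"
  unfolding L2_norm_def
  using assms by (intro real_sqrt_le_mono integral_mono power_mono) (auto simp: L2_def)

lemma L2_inner_tendsto:
  assumes "\<And>k. f k \<in> L2 \<Omega>" "g \<in> L2 \<Omega>" "h \<in> L2 \<Omega>" "(\<lambda>k. L2_norm \<Omega> (\<lambda>x. f k x - g x)) \<longlonglongrightarrow> 0"
  shows "(\<lambda>k. L2_inner \<Omega> (f k) h) \<longlonglongrightarrow> L2_inner \<Omega> g h"
proof (rule LIM_zero_cancel, rule Lim_null_comparison)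
  show "eventually (\<lambda>k. norm (L2_inner \<Omega> (f k) h - L2_inner \<Omega> g h) \<le>
      L2_norm \<Omega> (\<lambda>x. f k x - g x) * L2_norm \<Omega> h) sequentially"
    using L2_Cauchy_Schwarz[OF L2_diff[OF assms(1,2)] assms(3)]
    by (simp add: L2_inner_diff_left[OF assms(1-3)])
  show "(\<lambda>k. L2_norm \<Omega> (\<lambda>x. f k x - g x) * L2_norm \<Omega> h) \<longlonglongrightarrow> 0"
    using tendsto_mult_right[OF assms(4), of "L2_norm \<Omega> h"] by simp
qed

section \<open>The fundamental lemma of the calculus of variations\<close>

text \<open>Test functions have to be smooth in the sense of \<open>C_k\<close>, so they are built from the classical flat
  function \<open>exp (- 1 / t)\<close>. Its derivatives are linear combinations of the functions
  \<open>t\<^sup>-\<^sup>j exp (- 1 / t)\<close>, a family closed under differentiation: smoothness of all members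
  follows by one induction over the order.\<close>

definition flat_exp :: "nat \<Rightarrow> real \<Rightarrow> real" where
  "flat_exp j t = (if t \<le> 0 then 0 else exp (- (1 / t)) / t ^ j)"

lemma tendsto_flat_exp_0: "(flat_exp j \<longlongrightarrow> 0) (at_right 0)"
proof -
  have "((\<lambda>t. inverse t ^ j / exp (inverse t)) \<longlongrightarrow> (0::real)) (at_right 0)"
    by (rule filterlim_compose[OF tendsto_power_div_exp_0 filterlim_inverse_at_top_right])
  then show ?thesis
  proof (rule Lim_transform_eventually)
    show "eventually (\<lambda>t. inverse t ^ j / exp (inverse t) = flat_exp j t) (at_right 0)"
      using eventually_at_right_less[of "0::real"]
      by eventually_elim (simp add: flat_exp_def exp_minus field_simps)
  qed
qed

lemma DERIV_flat_exp:
  "(flat_exp j has_real_derivative (flat_exp (j + 2) t - real j * flat_exp (j + 1) t)) (at t)"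
proof (cases t "0::real" rule: linorder_cases)
  case less
  have "((\<lambda>t. 0) has_real_derivative 0) (at t)" by simp
  then have "(flat_exp j has_real_derivative 0) (at t)"
    by (rule has_field_derivative_transform_within_open[of _ _ _ "{..<0}"])
       (use less in \<open>auto simp: flat_exp_def\<close>)
  then show ?thesis using less by (simp add: flat_exp_def)
next
  case greater
  have "((\<lambda>t. exp (- (1 / t)) / t ^ j) has_real_derivative
      (flat_exp (j + 2) t - real j * flat_exp (j + 1) t)) (at t)"
    using greater
    by (auto intro!: derivative_eq_intros simp: flat_exp_def field_simps power2_eq_square)
       (cases j; simp add: field_simps)
  then show ?thesis
    by (rule has_field_derivative_transform_within_open[of _ _ _ "{0<..}"])
       (use greater in \<open>auto simp: flat_exp_def\<close>)
next
  case equal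
  have "((\<lambda>h. flat_exp j h / h) \<longlongrightarrow> 0) (at_right 0)"
  proof (rule Lim_transform_eventually[OF tendsto_flat_exp_0[of "Suc j"]])
    show "eventually (\<lambda>h. flat_exp (Suc j) h = flat_exp j h / h) (at_right 0)"
      by (simp add: flat_exp_def mult.commute)
  qed
  moreover have "((\<lambda>h. flat_exp j h / h) \<longlongrightarrow> 0) (at_left 0)"
  proof (rule Lim_transform_eventually[OF tendsto_const])
    show "eventually (\<lambda>h. 0 = flat_exp j h / h) (at_left 0)"
      by (rule eventually_mono[OF eventually_at_left_real[of "-1" 0]]) (auto simp: flat_exp_def)
  qed
  ultimately have "((\<lambda>h. flat_exp j h / h) \<longlongrightarrow> 0) (at 0)"
    by (simp add: filterlim_split_at)
  then show ?thesis
    using equal by (simp add: DERIV_def flat_exp_def)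
qed

lemma C_k_flat_exp: "C_k k (\<lambda>x::real^'n. flat_exp j (c * x $ i + d))"
proof (induction k arbitrary: j)
  case 0
  have "isCont (flat_exp j) t" for t
    using DERIV_flat_exp by (rule DERIV_isCont)
  then have "continuous_on UNIV (flat_exp j)"
    by (simp add: continuous_at_imp_continuous_on)
  then show ?case
    by (auto intro!: continuous_on_compose2[of UNIV "flat_exp j"] continuous_intros)
next
  case (Suc k)
  have der: "((\<lambda>x::real^'n. flat_exp j (c * x $ i + d)) has_derivative
      (\<lambda>h. (flat_exp (j + 2) (c * x $ i + d) - real j * flat_exp (j + 1) (c * x $ i + d)) * (c * h $ i))) (at x)"
    for x
  proof -
    have "((\<lambda>x::real^'n. c * x $ i + d) has_derivative (\<lambda>h. c * h $ i)) (at x)"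
      by (auto intro!: derivative_eq_intros bounded_linear_imp_has_derivative)
    from has_derivative_compose[OF this DERIV_flat_exp[unfolded has_field_derivative_def]]
    show ?thesis by simp
  qed
  have eq: "partial_deriv m (\<lambda>x::real^'n. flat_exp j (c * x $ i + d)) =
      (\<lambda>x. (if m = i then c else 0) * (flat_exp (j + 2) (c * x $ i + d) + (- real j) * flat_exp (j + 1) (c * x $ i + d)))" for m
    by (rule ext) (simp only: partial_deriv_eq[OF der], simp add: axis_def algebra_simps)
  have "C_k k (partial_deriv m (\<lambda>x::real^'n. flat_exp j (c * x $ i + d)))" for m
    unfolding eq by (intro C_k_mult C_k_add C_k_const Suc)
  then show ?case
    using der by (auto simp: differentiable_def)
qed

text \<open>The shift by \<open>1\<close> moves the support strictly inside the box, so that boxes need only lie in the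
  open set and not have their closure in it.\<close>

definition bump :: "real^'n \<Rightarrow> real^'n \<Rightarrow> nat \<Rightarrow> real^'n \<Rightarrow> real" where
  "bump a b k x = (\<Prod>i\<in>UNIV. flat_exp 0 (real k * (x $ i - a $ i) - 1) * flat_exp 0 (real k * (b $ i - x $ i) - 1))"

lemma bump_in_Cc_inf:
  fixes a b :: "real^'n"
  assumes "box a b \<subseteq> \<Omega>" "k > 0"
  shows "bump a b k \<in> Cc_inf \<Omega>"
proof (rule Cc_infI)
  let ?a = "\<chi> i. a $ i + 1 / real k" and ?b = "\<chi> i. b $ i - 1 / real k"
  show "C_k l (bump a b k)" for l
  proof -
    have "C_k l (\<lambda>x::real^'n. flat_exp 0 (real k * (x $ i - a $ i) - 1))"
         "C_k l (\<lambda>x::real^'n. flat_exp 0 (real k * (b $ i - x $ i) - 1))" for i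
      using C_k_flat_exp[of l 0 "real k" i "- real k * a $ i - 1"]
        C_k_flat_exp[of l 0 "- real k" i "real k * b $ i - 1"]
      by (simp_all add: algebra_simps)
    then show ?thesis
      unfolding bump_def[abs_def] by (intro C_k_prod C_k_mult)
  qed
  show "compact (cbox ?a ?b)" by (rule compact_cbox)
  have pos: "0 < 1 / real k" using assms(2) by simp
  have "cbox ?a ?b \<subseteq> box a b"
  proof
    fix x assume x: "x \<in> cbox ?a ?b"
    have "a $ i < x $ i \<and> x $ i < b $ i" for i
    proof -
      have "a $ i + 1 / real k \<le> x $ i" "x $ i \<le> b $ i - 1 / real k"
        using x by (simp_all add: mem_box_cart)
      with pos show ?thesis by linarith
    qed
    then show "x \<in> box a b" by (simp add: mem_box_cart)
  qed
  with assms(1) show "cbox ?a ?b \<subseteq> \<Omega>" by blast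
  show "bump a b k x = 0" if "x \<notin> cbox ?a ?b" for x
  proof -
    have "\<not> (\<forall>i. a $ i + 1 / real k \<le> x $ i \<and> x $ i \<le> b $ i - 1 / real k)"
      using that by (simp add: mem_box_cart)
    then obtain i where "\<not> (a $ i + 1 / real k \<le> x $ i \<and> x $ i \<le> b $ i - 1 / real k)"
      by blast
    then have "real k * (x $ i - a $ i) \<le> 1 \<or> real k * (b $ i - x $ i) \<le> 1"
      using assms(2) by (auto simp: field_simps)
    then have "flat_exp 0 (real k * (x $ i - a $ i) - 1) * flat_exp 0 (real k * (b $ i - x $ i) - 1) = 0"
      by (auto simp: flat_exp_def)
    then show ?thesis
      unfolding bump_def by (intro prod_zero) auto
  qed
qed

lemma flat_exp_0_bounds: "0 \<le> flat_exp 0 t" "flat_exp 0 t \<le> 1"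
  by (simp_all add: flat_exp_def)

lemma bump_bounded: "\<bar>bump a b k x\<bar> \<le> 1"
proof -
  have "0 \<le> bump a b k x" "bump a b k x \<le> 1"
    unfolding bump_def
    by (auto intro!: prod_nonneg prod_le_1 mult_le_one simp: flat_exp_0_bounds)
  then show ?thesis by simp
qed

lemma tendsto_flat_exp_1:
  assumes "c > 0" shows "(\<lambda>k. flat_exp 0 (real k * c - 1)) \<longlonglongrightarrow> 1"
proof -
  have "filterlim (\<lambda>k. real k * c - 1) at_top sequentially"
    using filterlim_tendsto_pos_mult_at_top[OF tendsto_const assms filterlim_real_sequentially]
      filterlim_tendsto_add_at_top[OF tendsto_const[of "-1"], of "\<lambda>k. real k * c"]
    by (simp add: mult.commute)
  then have "(\<lambda>k. exp (- inverse (real k * c - 1))) \<longlonglongrightarrow> exp (- 0)"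
    by (intro tendsto_exp tendsto_minus tendsto_inverse_0_at_top)
  moreover have "eventually (\<lambda>k. exp (- inverse (real k * c - 1)) = flat_exp 0 (real k * c - 1)) sequentially"
    using filterlim_at_top_dense[THEN iffD1, OF \<open>filterlim (\<lambda>k. real k * c - 1) at_top sequentially\<close>, rule_format, of 0]
    by eventually_elim (simp add: flat_exp_def inverse_eq_divide)
  ultimately have "(\<lambda>k. flat_exp 0 (real k * c - 1)) \<longlonglongrightarrow> exp (- 0)"
    by (rule Lim_transform_eventually)
  then show ?thesis by simp
qed

lemma bump_tendsto_indicator: "(\<lambda>k. bump a b k x) \<longlonglongrightarrow> indicator (box a b) x"
proof (cases "x \<in> box a b")
  case True
  then have "(\<lambda>k. bump a b k x) \<longlonglongrightarrow> (\<Prod>i\<in>(UNIV::'a set). 1 * 1)"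
    unfolding bump_def by (intro tendsto_prod tendsto_mult tendsto_flat_exp_1) (auto simp: mem_box_cart)
  with True show ?thesis by simp
next
  case False
  then obtain i where i: "x $ i \<le> a $ i \<or> b $ i \<le> x $ i"
    by (force simp: mem_box_cart not_less)
  have "bump a b k x = 0" for k
  proof -
    have "real k * (x $ i - a $ i) \<le> 0 \<or> real k * (b $ i - x $ i) \<le> 0"
      using i by (auto simp: mult_le_0_iff)
    then have "flat_exp 0 (real k * (x $ i - a $ i) - 1) * flat_exp 0 (real k * (b $ i - x $ i) - 1) = 0"
      by (auto simp: flat_exp_def)
    then show ?thesis
      unfolding bump_def by (intro prod_zero) auto
  qed
  with False show ?thesis by simp
qed

text \<open>Boxes are closed under intersection and generate the Borel sets, so by Dynkin's argument the
  integral over every Borel set vanishes, in particular over \<open>{f > 0}\<close> and \<open>{f < 0}\<close>. The support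
  condition makes the integral over the whole space one over a box, which the step to complements needs.\<close>

lemma AE_0_if_box_integrals_0:
  fixes f :: "'a::euclidean_space \<Rightarrow> real"
  assumes int: "integrable lborel f"
    and box: "\<And>a b. (\<integral>x. indicator (box a b) x * f x \<partial>lborel) = 0"
    and supp: "\<And>x. x \<notin> box l u \<Longrightarrow> f x = 0"
  shows "AE x in lborel. f x = 0"
proof -
  have intA: "integrable lborel (\<lambda>x. indicator A x * f x)" if "A \<in> sets borel" for A
    using integrable_mult_indicator[of A lborel f] that int by simp
  have "indicator (box l u) x * f x = f x" for x
    using supp by (auto simp: indicator_def)
  with box[of l u] have total: "(\<integral>x. f x \<partial>lborel) = 0" by simp
  have zero: "(\<integral>x. indicator A x * f x \<partial>lborel) = 0" if "A \<in> sets borel" for A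
  proof -
    have "Int_stable (range (\<lambda>(a, b). box a b :: 'a set))"
      by (auto simp: Int_stable_def box_Int_box)
    moreover have "range (\<lambda>(a, b). box a b :: 'a set) \<subseteq> Pow UNIV"
      by auto
    moreover have "A \<in> sigma_sets UNIV (range (\<lambda>(a, b). box a b))"
      using that unfolding borel_eq_box by simp
    ultimately show ?thesis
    proof (induction rule: sigma_sets_induct_disjoint)
      case (basic A)
      then show ?case using box by auto
    next
      case empty
      then show ?case by simp
    next
      case (compl A)
      then have "A \<in> sets borel" by (simp add: borel_eq_box)
      moreover have "(\<lambda>x. indicator (UNIV - A) x * f x) = (\<lambda>x. f x - indicator A x * f x)"
        by (auto simp: fun_eq_iff indicator_def)
      ultimately show ?case
        using intA[of A] int total compl by simp
    next
      case (union A)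
      then have A: "\<And>i. A i \<in> sets lborel" "(\<Union>i. A i) \<in> sets lborel"
        by (auto simp: borel_eq_box intro!: sigma_sets.Union)
      have "(LINT x:(\<Union>i. A i)|lborel. f x) = (\<Sum>i. (LINT x:(A i)|lborel. f x))"
      proof (rule lebesgue_integral_countable_add[OF A(1)])
        show "A i \<inter> A j = {}" if "i \<noteq> j" for i j
          using union(1) that by (auto simp: disjoint_family_on_def)
        show "set_integrable lborel (\<Union>i. A i) f"
          using intA[of "\<Union>i. A i"] A(2) by (simp add: set_integrable_def)
      qed
      then show ?case
        using union(3) by (simp add: set_lebesgue_integral_def)
    qed
  qed
  have [measurable]: "f \<in> borel_measurable borel" using int by auto
  have sgn: "AE x in lborel. \<not> 0 < s * f x" for s :: real
  proof -
    let ?S = "{x. 0 < s * f x}"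
    have S: "?S \<in> sets borel" by measurable
    have "(\<integral>x. s * (indicator ?S x * f x) \<partial>lborel) = 0"
      using zero[OF S] by simp
    then have "AE x in lborel. s * (indicator ?S x * f x) = 0"
      by (subst (asm) integral_nonneg_eq_0_iff_AE)
         (use intA[OF S] in \<open>auto simp: indicator_def\<close>)
    then show ?thesis
      by eventually_elim (auto simp: indicator_def)
  qed
  show ?thesis
    using sgn[of 1] sgn[of "-1"] by eventually_elim simp
qed

text \<open>Bumps are bounded by \<open>1\<close> and converge to the indicator of their box, so \<open>f\<close> integrates to zero over
  every box inside \<open>\<Omega>\<close>. Restricting \<open>f\<close> to one box of a countable cover of \<open>\<Omega>\<close> reduces the claim to the
  previous lemma, since intersections of boxes are boxes.\<close>

lemma fundamental_lemma:
  fixes f :: "real^'n \<Rightarrow> real"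
  assumes "open \<Omega>" and int: "integrable (lebesgue_on \<Omega>) f"
    and zero: "\<And>\<phi>. \<phi> \<in> Cc_inf \<Omega> \<Longrightarrow> (\<integral>x. f x * \<phi> x \<partial>(lebesgue_on \<Omega>)) = 0"
  shows "AE x in lebesgue_on \<Omega>. f x = 0"
proof -
  have \<Omega>: "\<Omega> \<in> sets lebesgue" using assms(1) by simp
  define F where "F x = (if x \<in> \<Omega> then f x else 0)" for x
  have F: "integrable lebesgue F"
    unfolding F_def using int Lebesgue_Measure.integrable_restrict_UNIV[OF \<Omega>, of f] by simp
  then have "F \<in> borel_measurable (completion lborel)" by simp
  from completion_ex_borel_measurable_real[OF this]
  \<comment> \<open>The sigma-algebra argument runs over Borel sets and needs a Borel version of \<open>f\<close>.\<close>
  obtain G where G[measurable]: "G \<in> borel_measurable lborel" and FG: "AE x in lborel. F x = G x"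
    by blast
  have FG': "AE x in lebesgue. F x = G x" by (rule AE_completion[OF FG])
  have "integrable lebesgue G"
    using F by (rule integrable_cong_AE_imp) (use FG' in \<open>auto intro: measurable_completion[OF G]\<close>)
  then have Gint: "integrable lborel G"
    by (simp add: integrable_completion)
  have Gzero: "(\<integral>x. indicator (box a b) x * G x \<partial>lborel) = 0" if "box a b \<subseteq> \<Omega>" for a b
  proof -
    have cont: "bump a b (Suc k) \<in> borel_measurable borel" for k
      by (rule borel_measurable_continuous_onI[OF Cc_inf_continuous[OF bump_in_Cc_inf[OF that]]]) simp
    have "(\<integral>x. bump a b (Suc k) x * G x \<partial>lborel) = 0" for k
    proof -
      let ?\<phi> = "bump a b (Suc k)"
      have \<phi>: "?\<phi> \<in> Cc_inf \<Omega>" by (rule bump_in_Cc_inf[OF that]) simp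
      have m: "?\<phi> \<in> borel_measurable lborel" using cont by simp
      then have m': "?\<phi> \<in> borel_measurable lebesgue" by (rule measurable_completion)
      have "(\<integral>x. ?\<phi> x * G x \<partial>lborel) = (\<integral>x. ?\<phi> x * G x \<partial>lebesgue)"
        using integral_completion[of "\<lambda>x. ?\<phi> x * G x" lborel] m G by simp
      also have "\<dots> = (\<integral>x. ?\<phi> x * F x \<partial>lebesgue)"
        using FG' F m' measurable_completion[OF G] by (intro integral_cong_AE) auto
      also have "\<dots> = (\<integral>x. (if x \<in> \<Omega> then f x * ?\<phi> x else 0) \<partial>lebesgue)"
        by (rule Bochner_Integration.integral_cong) (auto simp: F_def)
      also have "\<dots> = 0"
        using zero[OF \<phi>] by (simp add: Lebesgue_Measure.integral_restrict_UNIV[OF \<Omega>])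
      finally show ?thesis .
    qed
    moreover have "(\<lambda>k. \<integral>x. bump a b (Suc k) x * G x \<partial>lborel) \<longlonglongrightarrow> (\<integral>x. indicator (box a b) x * G x \<partial>lborel)"
    proof (rule integral_dominated_convergence)
      show "AE x in lborel. (\<lambda>k. bump a b (Suc k) x * G x) \<longlonglongrightarrow> indicator (box a b) x * G x"
        by (intro AE_I2 tendsto_intros LIMSEQ_Suc bump_tendsto_indicator)
      show "AE x in lborel. norm (bump a b (Suc k) x * G x) \<le> \<bar>G x\<bar>" for k
        using mult_right_mono[OF bump_bounded abs_ge_zero] by (intro AE_I2) (simp add: abs_mult)
    qed (use cont Gint in auto)
    ultimately show ?thesis
      by (simp add: LIMSEQ_const_iff)
  qed
  obtain D where D: "countable D" "D \<subseteq> Pow \<Omega>" "\<And>X. X \<in> D \<Longrightarrow> \<exists>a b. X = box a b" "\<Union>D = \<Omega>"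
    using open_countable_Union_open_box[OF assms(1)] by metis
  have "AE x in lborel. indicator X x * G x = 0" if X: "X \<in> D" for X
  proof -
    obtain l u where lu: "X = box l u" "box l u \<subseteq> \<Omega>"
      using D(2) D(3)[OF X] X by auto
    show ?thesis
    proof (rule AE_0_if_box_integrals_0)
      show "integrable lborel (\<lambda>x. indicator X x * G x)"
        using integrable_mult_indicator[of X lborel G] Gint lu by simp
      show "(\<integral>x. indicator (box a b) x * (indicator X x * G x) \<partial>lborel) = 0" for a b
      proof -
        obtain c d where cd: "box a b \<inter> X = box c d"
          using lu by (simp add: box_Int_box)
        have "(\<lambda>x. indicator (box a b) x * (indicator X x * G x)) = (\<lambda>x. indicator (box c d) x * G x)"
          unfolding cd[symmetric] by (auto simp: fun_eq_iff indicator_def)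
        moreover have "box c d \<subseteq> \<Omega>" using cd lu by blast
        ultimately show ?thesis using Gzero by simp
      qed
      show "indicator X x * G x = 0" if "x \<notin> box l u" for x
        using that lu by simp
    qed
  qed
  then have "AE x in lborel. \<forall>X\<in>D. indicator X x * G x = 0"
    using AE_ball_countable[OF D(1), of "\<lambda>x X. indicator X x * G x = 0" lborel] by blast
  then have "AE x in lborel. x \<in> \<Omega> \<longrightarrow> f x = 0"
    using FG
  proof eventually_elim
    case (elim x)
    show ?case
    proof
      assume "x \<in> \<Omega>"
      then obtain X where "X \<in> D" "x \<in> X" using D(4) by blast
      with elim have "G x = 0" by fastforce
      with elim \<open>x \<in> \<Omega>\<close> show "f x = 0" by (simp add: F_def)
    qed
  qed
  then have "AE x in lebesgue. x \<in> \<Omega> \<longrightarrow> f x = 0"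
    by (rule AE_completion)
  then show ?thesis
    using \<Omega> by (simp add: AE_restrict_space_iff)
qed

section \<open>Weak derivatives\<close>

lemma grad_add:
  assumes "\<phi> \<in> Cc_inf \<Omega>" "\<psi> \<in> Cc_inf \<Omega>"
  shows "grad (\<lambda>x. \<phi> x + \<psi> x) = (\<lambda>x. grad \<phi> x + grad \<psi> x)"
  by (simp add: fun_eq_iff vec_eq_iff
      partial_deriv_add[OF Cc_inf_differentiable[OF assms(1)] Cc_inf_differentiable[OF assms(2)]])

lemma grad_scaleR:
  assumes "\<phi> \<in> Cc_inf \<Omega>"
  shows "grad (\<lambda>x. c *\<^sub>R \<phi> x) = (\<lambda>x. c *\<^sub>R grad \<phi> x)"
  by (simp only: fun_eq_iff vec_eq_iff grad_nth vector_scaleR_component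
      partial_deriv_bounded_linear[OF bounded_linear_scaleR_right Cc_inf_differentiable[OF assms]]) simp

lemma grad_diff:
  assumes "\<phi> \<in> Cc_inf \<Omega>" "\<psi> \<in> Cc_inf \<Omega>"
  shows "grad (\<lambda>x. \<phi> x - \<psi> x) = (\<lambda>x. grad \<phi> x - grad \<psi> x)"
  using grad_add[OF assms(1) Cc_inf_scaleR[OF assms(2), of "-1"]] grad_scaleR[OF assms(2), of "-1"]
  by simp

lemma has_grad_grad:
  assumes "\<Omega> \<in> sets lebesgue" "\<phi> \<in> Cc_inf \<Omega>"
  shows "has_grad \<Omega> \<phi> (grad \<phi>)"
  unfolding has_grad_def
  by (auto intro!: Cc_inf_L2 integration_by_parts Cc_inf_grad Cc_inf_C_k assms
      intro: Cc_inf_C_k[OF assms(2)])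

lemma has_grad_diff:
  assumes "\<Omega> \<in> sets lebesgue" "has_grad \<Omega> u g" "has_grad \<Omega> v h"
  shows "has_grad \<Omega> (\<lambda>x. u x - v x) (\<lambda>x. g x - h x)"
  unfolding has_grad_def
proof (intro conjI ballI allI)
  have L: "u \<in> L2 \<Omega>" "g \<in> L2 \<Omega>" "v \<in> L2 \<Omega>" "h \<in> L2 \<Omega>"
    using assms by (auto simp: has_grad_def)
  then show "(\<lambda>x. u x - v x) \<in> L2 \<Omega>" "(\<lambda>x. g x - h x) \<in> L2 \<Omega>"
    by (auto intro: L2_diff)
  fix \<phi> :: "real^'a \<Rightarrow> real" and i assume \<phi>: "\<phi> \<in> Cc_inf \<Omega>"
  have "(\<integral>x. (u x - v x) * partial_deriv i \<phi> x \<partial>(lebesgue_on \<Omega>)) =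
      (\<integral>x. u x * partial_deriv i \<phi> x \<partial>(lebesgue_on \<Omega>)) - (\<integral>x. v x * partial_deriv i \<phi> x \<partial>(lebesgue_on \<Omega>))"
    using L2_real_mult_integrable[OF L(1) Cc_inf_L2[OF assms(1) Cc_inf_partial_deriv[OF \<phi>]]]
      L2_real_mult_integrable[OF L(3) Cc_inf_L2[OF assms(1) Cc_inf_partial_deriv[OF \<phi>]]]
    by (simp add: left_diff_distrib)
  also have "\<dots> = - (\<integral>x. g x $ i * \<phi> x \<partial>(lebesgue_on \<Omega>)) + (\<integral>x. h x $ i * \<phi> x \<partial>(lebesgue_on \<Omega>))"
    using assms(2,3) \<phi> by (simp add: has_grad_def)
  also have "\<dots> = - (\<integral>x. (g x - h x) $ i * \<phi> x \<partial>(lebesgue_on \<Omega>))"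
    using L2_real_mult_integrable[OF L2_nth[OF L(2)] Cc_inf_L2[OF assms(1) \<phi>]]
      L2_real_mult_integrable[OF L2_nth[OF L(4)] Cc_inf_L2[OF assms(1) \<phi>]]
    by (simp add: left_diff_distrib)
  finally show "(\<integral>x. (u x - v x) * partial_deriv i \<phi> x \<partial>(lebesgue_on \<Omega>)) =
      - (\<integral>x. (g x - h x) $ i * \<phi> x \<partial>(lebesgue_on \<Omega>))" .
qed

lemma has_grad_unique_AE:
  assumes \<Omega>: "open \<Omega>" "\<Omega> \<in> lmeasurable" and "has_grad \<Omega> u g" "has_grad \<Omega> u h"
  shows "AE x in lebesgue_on \<Omega>. g x = h x"
proof -
  note \<Omega>' = fmeasurableD[OF \<Omega>(2)]
  have *: "has_grad \<Omega> (\<lambda>x. 0) (\<lambda>x. g x - h x)"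
    using has_grad_diff[OF \<Omega>' assms(3,4)] by simp
  then have L: "(\<lambda>x. (g x - h x) $ i) \<in> L2 \<Omega>" for i
    by (auto simp: has_grad_def simp del: vector_minus_component intro: L2_nth)
  have "AE x in lebesgue_on \<Omega>. (g x - h x) $ i = 0" for i
  proof (rule fundamental_lemma[OF \<Omega>(1)])
    show "integrable (lebesgue_on \<Omega>) (\<lambda>x. (g x - h x) $ i)"
      using L2_integral_norm_le(1)[OF \<Omega>(2) L[of i]] L2_measurable[OF L[of i]]
      by (rule integrable_norm_cancel)
    show "(\<integral>x. (g x - h x) $ i * \<phi> x \<partial>(lebesgue_on \<Omega>)) = 0" if "\<phi> \<in> Cc_inf \<Omega>" for \<phi>
      using * that by (simp add: has_grad_def)
  qed
  then have "AE x in lebesgue_on \<Omega>. \<forall>i\<in>UNIV. (g x - h x) $ i = 0"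
    by (intro AE_finite_allI) auto
  then show ?thesis
    by eventually_elim (simp add: vec_eq_iff)
qed

lemma has_grad_cong_AE:
  assumes "\<Omega> \<in> sets lebesgue" "has_grad \<Omega> u g" "h \<in> L2 \<Omega>" "AE x in lebesgue_on \<Omega>. g x = h x"
  shows "has_grad \<Omega> u h"
proof -
  have "(\<integral>x. g x $ i * \<phi> x \<partial>(lebesgue_on \<Omega>)) = (\<integral>x. h x $ i * \<phi> x \<partial>(lebesgue_on \<Omega>))"
    if "\<phi> \<in> Cc_inf \<Omega>" for \<phi> i
  proof (rule integral_cong_AE)
    have "g \<in> L2 \<Omega>" using assms(2) by (simp add: has_grad_def)
    from L2_real_mult_integrable[OF L2_nth[OF this] Cc_inf_L2[OF assms(1) that]]
      L2_real_mult_integrable[OF L2_nth[OF assms(3)] Cc_inf_L2[OF assms(1) that]]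
    show "(\<lambda>x. g x $ i * \<phi> x) \<in> borel_measurable (lebesgue_on \<Omega>)"
      "(\<lambda>x. h x $ i * \<phi> x) \<in> borel_measurable (lebesgue_on \<Omega>)"
      by auto
    show "AE x in lebesgue_on \<Omega>. g x $ i * \<phi> x = h x $ i * \<phi> x"
      using assms(4) by eventually_elim simp
  qed
  then show ?thesis
    using assms(2,3) by (simp add: has_grad_def)
qed

lemma has_grad_limit:
  assumes \<Omega>: "\<Omega> \<in> sets lebesgue" and k: "\<And>k. has_grad \<Omega> (u k) (g k)"
    and L: "v \<in> L2 \<Omega>" "h \<in> L2 \<Omega>"
    and lim: "(\<lambda>k. L2_norm \<Omega> (\<lambda>x. u k x - v x)) \<longlonglongrightarrow> 0" "(\<lambda>k. L2_norm \<Omega> (\<lambda>x. g k x - h x)) \<longlonglongrightarrow> 0"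
  shows "has_grad \<Omega> v h"
proof -
  have "(\<integral>x. v x * partial_deriv i \<phi> x \<partial>(lebesgue_on \<Omega>)) = - (\<integral>x. h x $ i * \<phi> x \<partial>(lebesgue_on \<Omega>))"
    if \<phi>: "\<phi> \<in> Cc_inf \<Omega>" for \<phi> i
  proof -
    let ?a = "\<lambda>x. \<phi> x *\<^sub>R axis i (1::real)"
    have L2: "u k \<in> L2 \<Omega>" "g k \<in> L2 \<Omega>" for k using k by (auto simp: has_grad_def)
    have a: "?a \<in> Cc_inf \<Omega>"
      by (rule Cc_inf_bounded_linear[OF bounded_linear_scaleR_left \<phi>])
    have comp: "L2_inner \<Omega> f ?a = (\<integral>x. f x $ i * \<phi> x \<partial>(lebesgue_on \<Omega>))" for f
      by (simp add: L2_inner_def inner_axis mult.commute)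
    have eq: "L2_inner \<Omega> (u k) (partial_deriv i \<phi>) = - L2_inner \<Omega> (g k) ?a" for k
      using k[of k] \<phi> unfolding comp by (simp add: L2_inner_def has_grad_def)
    have "(\<lambda>k. L2_inner \<Omega> (u k) (partial_deriv i \<phi>)) \<longlonglongrightarrow> L2_inner \<Omega> v (partial_deriv i \<phi>)"
      by (rule L2_inner_tendsto[OF L2(1) L(1) Cc_inf_L2[OF \<Omega> Cc_inf_partial_deriv[OF \<phi>]] lim(1)])
    moreover have "(\<lambda>k. - L2_inner \<Omega> (g k) ?a) \<longlonglongrightarrow> - L2_inner \<Omega> h ?a"
      by (rule tendsto_minus[OF L2_inner_tendsto[OF L2(2) L(2) Cc_inf_L2[OF \<Omega> a] lim(2)]])
    ultimately have "L2_inner \<Omega> v (partial_deriv i \<phi>) = - L2_inner \<Omega> h ?a"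
      unfolding eq by (rule LIMSEQ_unique)
    then show ?thesis
      unfolding comp by (simp add: L2_inner_def)
  qed
  with L show ?thesis by (simp add: has_grad_def)
qed

text \<open>The approximants in the definition of the closure come with weak gradients of their own; uniqueness
  of weak gradients identifies them with \<open>g - grad \<phi>\<close> for the given representative \<open>g\<close>.\<close>

lemma H1_0_approx:
  assumes \<Omega>: "open \<Omega>" "\<Omega> \<in> lmeasurable" and u: "u \<in> H1_0 \<Omega>" "has_grad \<Omega> u g" and "e > 0"
  shows "\<exists>\<phi>\<in>Cc_inf \<Omega>. L2_norm \<Omega> (\<lambda>x. u x - \<phi> x) < e \<and> L2_norm \<Omega> (\<lambda>x. g x - grad \<phi> x) < e"
proof -
  note \<Omega>' = fmeasurableD[OF \<Omega>(2)]
  obtain \<phi> z where \<phi>: "\<phi> \<in> Cc_inf \<Omega>" and z: "has_grad \<Omega> (\<lambda>x. u x - \<phi> x) z" and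
    less: "sqrt ((L2_norm \<Omega> (\<lambda>x. u x - \<phi> x))\<^sup>2 + (L2_norm \<Omega> z)\<^sup>2) < e"
    using u(1) \<open>e > 0\<close> unfolding H1_0_def Cc_closure_def by blast
  have *: "has_grad \<Omega> (\<lambda>x. u x - \<phi> x) (\<lambda>x. g x - grad \<phi> x)"
    by (rule has_grad_diff[OF \<Omega>' u(2) has_grad_grad[OF \<Omega>' \<phi>]])
  have "L2_norm \<Omega> (\<lambda>x. g x - grad \<phi> x) = L2_norm \<Omega> z"
    using * z by (intro L2_norm_cong_AE has_grad_unique_AE[OF \<Omega> * z]) (auto simp: has_grad_def)
  moreover have "L2_norm \<Omega> (\<lambda>x. u x - \<phi> x) < e"
    using less real_sqrt_sum_squares_ge1[of "L2_norm \<Omega> (\<lambda>x. u x - \<phi> x)" "L2_norm \<Omega> z"] by linarith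
  moreover have "L2_norm \<Omega> z < e"
    using less real_sqrt_sum_squares_ge2[of "L2_norm \<Omega> z" "L2_norm \<Omega> (\<lambda>x. u x - \<phi> x)"] by linarith
  ultimately show ?thesis using \<phi> by auto
qed

lemma H1_0I:
  assumes \<Omega>: "\<Omega> \<in> sets lebesgue" and u: "has_grad \<Omega> u g"
    and \<phi>: "\<And>k. \<phi> k \<in> Cc_inf \<Omega>" "(\<lambda>k. L2_norm \<Omega> (\<lambda>x. \<phi> k x - u x)) \<longlonglongrightarrow> 0"
      "(\<lambda>k. L2_norm \<Omega> (\<lambda>x. grad (\<phi> k) x - g x)) \<longlonglongrightarrow> 0"
  shows "u \<in> H1_0 \<Omega>"
  unfolding H1_0_def Cc_closure_def mem_Collect_eq
proof (intro conjI allI impI)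
  show "\<exists>w. has_grad \<Omega> u w" using u by blast
  fix e :: real assume "e > 0"
  have "(\<lambda>k. sqrt ((L2_norm \<Omega> (\<lambda>x. \<phi> k x - u x))\<^sup>2 + (L2_norm \<Omega> (\<lambda>x. grad (\<phi> k) x - g x))\<^sup>2)) \<longlonglongrightarrow> sqrt (0\<^sup>2 + 0\<^sup>2)"
    by (intro tendsto_intros \<phi>)
  then have "eventually (\<lambda>k. sqrt ((L2_norm \<Omega> (\<lambda>x. \<phi> k x - u x))\<^sup>2 + (L2_norm \<Omega> (\<lambda>x. grad (\<phi> k) x - g x))\<^sup>2) < e) sequentially"
    using \<open>e > 0\<close> by (intro order_tendstoD(2)[of _ 0]) simp_all
  then obtain k where "sqrt ((L2_norm \<Omega> (\<lambda>x. \<phi> k x - u x))\<^sup>2 + (L2_norm \<Omega> (\<lambda>x. grad (\<phi> k) x - g x))\<^sup>2) < e"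
    by (auto simp: eventually_sequentially)
  then have "sqrt ((L2_norm \<Omega> (\<lambda>x. u x - \<phi> k x))\<^sup>2 + (L2_norm \<Omega> (\<lambda>x. g x - grad (\<phi> k) x))\<^sup>2) < e"
    by (simp only: L2_norm_minus_commute[of \<Omega> u] L2_norm_minus_commute[of \<Omega> g])
  then show "\<exists>\<phi>\<in>Cc_inf \<Omega>. \<exists>z. has_grad \<Omega> (\<lambda>x. u x - \<phi> x) z \<and>
      sqrt ((L2_norm \<Omega> (\<lambda>x. u x - \<phi> x))\<^sup>2 + (L2_norm \<Omega> z)\<^sup>2) < e"
    using has_grad_diff[OF \<Omega> u has_grad_grad[OF \<Omega> \<phi>(1)]] \<phi>(1) by blast
qed

text \<open>Testing the weak gradient with \<open>\<partial>\<^sub>n \<phi>\<close> and with \<open>\<partial>\<^sub>m \<phi>\<close> moves both derivatives onto \<open>\<phi>\<close>, where they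
  commute.\<close>

lemma has_curl_grad:
  fixes \<Omega> :: "(real^'n::{finite,wellorder}) set"
  assumes \<Omega>: "\<Omega> \<in> sets lebesgue" and u: "has_grad \<Omega> u g"
  shows "has_curl \<Omega> g (\<lambda>x. 0)"
proof -
  have g: "g \<in> L2 \<Omega>" using u by (simp add: has_grad_def)
  have "(\<integral>x. g x $ m * partial_deriv n \<phi> x - g x $ n * partial_deriv m \<phi> x \<partial>(lebesgue_on \<Omega>)) = 0"
    if \<phi>: "\<phi> \<in> Cc_inf \<Omega>" for \<phi> n m
  proof -
    have int: "integrable (lebesgue_on \<Omega>) (\<lambda>x. g x $ i * partial_deriv j \<phi> x)" for i j
      by (intro L2_real_mult_integrable L2_nth g Cc_inf_L2 Cc_inf_partial_deriv \<phi> \<Omega>)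
    have by_grad: "(\<integral>x. g x $ i * partial_deriv j \<phi> x \<partial>(lebesgue_on \<Omega>)) =
        - (\<integral>x. u x * partial_deriv i (partial_deriv j \<phi>) x \<partial>(lebesgue_on \<Omega>))" for i j
      using u Cc_inf_partial_deriv[OF \<phi>, of j] by (simp add: has_grad_def)
    show ?thesis
      by (simp add: int by_grad mixed_partial_deriv_commute[OF Cc_inf_C_k[OF \<phi>], of n m])
  qed
  with g show ?thesis
    by (simp add: has_curl_def L2_zero)
qed

lemma has_curl_diff:
  fixes \<Omega> :: "(real^'n::{finite,wellorder}) set"
  assumes \<Omega>: "\<Omega> \<in> sets lebesgue" and v: "has_curl \<Omega> v w" "has_curl \<Omega> v' w'"
  shows "has_curl \<Omega> (\<lambda>x. v x - v' x) (\<lambda>x. w x - w' x)"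
  unfolding has_curl_def
proof (intro conjI ballI allI)
  have L: "v \<in> L2 \<Omega>" "w \<in> L2 \<Omega>" "v' \<in> L2 \<Omega>" "w' \<in> L2 \<Omega>"
    using v by (auto simp: has_curl_def)
  then show "(\<lambda>x. v x - v' x) \<in> L2 \<Omega>" "(\<lambda>x. w x - w' x) \<in> L2 \<Omega>"
    by (auto intro: L2_diff)
  fix \<phi> :: "real^'n::{finite,wellorder} \<Rightarrow> real" and n m assume \<phi>: "\<phi> \<in> Cc_inf \<Omega>"
  have int: "integrable (lebesgue_on \<Omega>) (\<lambda>x. f x $ i * partial_deriv j \<phi> x)" if "f \<in> L2 \<Omega>" for f i j
    by (intro L2_real_mult_integrable L2_nth that Cc_inf_L2 Cc_inf_partial_deriv \<phi> \<Omega>)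
  have "integrable (lebesgue_on \<Omega>) (\<lambda>x. f x $ n $ m * \<phi> x)" if "f \<in> L2 \<Omega>" for f :: "real^'n::_ \<Rightarrow> real^'n::_^'n::_"
    by (intro L2_real_mult_integrable L2_nth that Cc_inf_L2 \<phi> \<Omega>)
  then have w: "(\<integral>x. (w x - w' x) $ n $ m * \<phi> x \<partial>(lebesgue_on \<Omega>)) =
      (\<integral>x. w x $ n $ m * \<phi> x \<partial>(lebesgue_on \<Omega>)) - (\<integral>x. w' x $ n $ m * \<phi> x \<partial>(lebesgue_on \<Omega>))"
    using L by (simp add: left_diff_distrib)
  have "(\<integral>x. (v x - v' x) $ m * partial_deriv n \<phi> x - (v x - v' x) $ n * partial_deriv m \<phi> x \<partial>(lebesgue_on \<Omega>)) =
      (\<integral>x. v x $ m * partial_deriv n \<phi> x - v x $ n * partial_deriv m \<phi> x \<partial>(lebesgue_on \<Omega>)) -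
      (\<integral>x. v' x $ m * partial_deriv n \<phi> x - v' x $ n * partial_deriv m \<phi> x \<partial>(lebesgue_on \<Omega>))"
    using int[OF L(1)] int[OF L(3)] by (simp add: left_diff_distrib)
  moreover have "(if n < m then (\<integral>x. v x $ m * partial_deriv n \<phi> x - v x $ n * partial_deriv m \<phi> x \<partial>(lebesgue_on \<Omega>)) else 0)
      = - (\<integral>x. w x $ n $ m * \<phi> x \<partial>(lebesgue_on \<Omega>))"
    "(if n < m then (\<integral>x. v' x $ m * partial_deriv n \<phi> x - v' x $ n * partial_deriv m \<phi> x \<partial>(lebesgue_on \<Omega>)) else 0)
      = - (\<integral>x. w' x $ n $ m * \<phi> x \<partial>(lebesgue_on \<Omega>))"
    using v \<phi> unfolding has_curl_def by blast+
  ultimately show "(if n < m then (\<integral>x. (v x - v' x) $ m * partial_deriv n \<phi> x - (v x - v' x) $ n * partial_deriv m \<phi> x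
      \<partial>(lebesgue_on \<Omega>)) else 0) = - (\<integral>x. (w x - w' x) $ n $ m * \<phi> x \<partial>(lebesgue_on \<Omega>))"
    unfolding w by (simp split: if_splits)
qed

section \<open>Orthogonal projection onto the gradients\<close>

text \<open>Partial integration of \<open>1 = \<partial>\<^sub>i x\<^sub>i\<close> against \<open>\<phi>\<^sup>2\<close> gives \<open>\<parallel>\<phi>\<parallel>\<^sup>2 = - 2 \<langle>x\<^sub>i \<phi>, \<partial>\<^sub>i \<phi>\<rangle> \<le> 2 R \<parallel>\<phi>\<parallel> \<parallel>\<partial>\<^sub>i \<phi>\<parallel>\<close> for \<open>\<Omega>\<close>
  contained in the ball of radius \<open>R\<close> about the origin.\<close>

lemma Poincare:
  assumes \<Omega>: "\<Omega> \<in> sets lebesgue" and "bounded \<Omega>"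
  shows "\<exists>C>0. \<forall>\<phi>\<in>Cc_inf \<Omega>. L2_norm \<Omega> \<phi> \<le> C * L2_norm \<Omega> (grad \<phi>)"
proof -
  obtain R where R: "R > 0" "\<And>x. x \<in> \<Omega> \<Longrightarrow> norm x \<le> R"
    using assms(2) unfolding bounded_pos by blast
  have "L2_norm \<Omega> \<phi> \<le> (2 * R) * L2_norm \<Omega> (grad \<phi>)" if \<phi>: "\<phi> \<in> Cc_inf \<Omega>" for \<phi> :: "real^'a \<Rightarrow> real"
  proof -
    fix i :: 'a
    let ?u = "\<lambda>x. x $ i * \<phi> x" and ?M = "lebesgue_on \<Omega>"
    have u: "?u \<in> Cc_inf \<Omega>"
      by (rule Cc_inf_mult[OF C_k_coord \<phi>])
    note L2 = Cc_inf_L2[OF \<Omega> \<phi>] Cc_inf_L2[OF \<Omega> u] Cc_inf_L2[OF \<Omega> Cc_inf_partial_deriv[OF \<phi>, of i]]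
    have "\<forall>x. (\<lambda>x::real^'a. x $ i) differentiable (at x)"
      using C_k_coord[of "Suc 0" i] by simp
    from partial_deriv_mult[OF this Cc_inf_differentiable[OF \<phi>], of i]
    have pu: "partial_deriv i ?u x = x $ i * partial_deriv i \<phi> x + \<phi> x" for x
      by (simp add: partial_deriv_coord)
    have "L2_inner \<Omega> ?u (partial_deriv i \<phi>) = - (\<integral>x. partial_deriv i ?u x * \<phi> x \<partial>?M)"
      using integration_by_parts[OF \<Omega> Cc_inf_C_k[OF u] \<phi>, of i] by (simp add: L2_inner_def)
    also have "(\<integral>x. partial_deriv i ?u x * \<phi> x \<partial>?M) = (\<integral>x. ?u x * partial_deriv i \<phi> x + \<phi> x * \<phi> x \<partial>?M)"
      by (simp only: pu) (simp add: algebra_simps)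
    also have "\<dots> = L2_inner \<Omega> ?u (partial_deriv i \<phi>) + L2_inner \<Omega> \<phi> \<phi>"
      using L2_real_mult_integrable[OF L2(2,3)] L2_real_mult_integrable[OF L2(1,1)]
      by (simp add: L2_inner_def)
    finally have "(L2_norm \<Omega> \<phi>)\<^sup>2 \<le> 2 * \<bar>L2_inner \<Omega> ?u (partial_deriv i \<phi>)\<bar>"
      by (simp add: L2_norm_power2)
    also have "\<dots> \<le> 2 * (L2_norm \<Omega> ?u * L2_norm \<Omega> (partial_deriv i \<phi>))"
      using L2_Cauchy_Schwarz[OF L2(2,3)] by simp
    also have "\<dots> \<le> 2 * ((R * L2_norm \<Omega> \<phi>) * L2_norm \<Omega> (grad \<phi>))"
    proof (intro mult_left_mono mult_mono)
      have "norm (?u x) \<le> norm (R *\<^sub>R \<phi> x)" if "x \<in> \<Omega>" for x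
        using component_le_norm_cart[of x i] R(1) R(2)[OF that]
        by (simp add: abs_mult mult_right_mono)
      then have "L2_norm \<Omega> ?u \<le> L2_norm \<Omega> (\<lambda>x. R *\<^sub>R \<phi> x)"
        by (rule L2_norm_mono[OF L2(2) L2_scaleR[OF L2(1)]])
      then show "L2_norm \<Omega> ?u \<le> R * L2_norm \<Omega> \<phi>"
        using R(1) unfolding L2_norm_scaleR by simp
      show "L2_norm \<Omega> (partial_deriv i \<phi>) \<le> L2_norm \<Omega> (grad \<phi>)"
        using component_le_norm_cart[of "grad \<phi> _" i]
        by (intro L2_norm_mono L2(3) Cc_inf_L2[OF \<Omega>] Cc_inf_grad[OF \<phi>]) simp
    qed (use R in auto)
    finally have "L2_norm \<Omega> \<phi> * L2_norm \<Omega> \<phi> \<le> L2_norm \<Omega> \<phi> * ((2 * R) * L2_norm \<Omega> (grad \<phi>))"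
      by (simp add: power2_eq_square algebra_simps)
    then show ?thesis
      using R(1) by (cases "L2_norm \<Omega> \<phi> = 0") (auto simp: mult_le_cancel_left less_le)
  qed
  then show ?thesis
    using R(1) by (intro exI[of _ "2 * R"]) auto
qed

lemma L2_parallelogram:
  assumes "f \<in> L2 \<Omega>" "g \<in> L2 \<Omega>"
  shows "(L2_norm \<Omega> (\<lambda>x. f x - g x))\<^sup>2 =
    2 * (L2_norm \<Omega> f)\<^sup>2 + 2 * (L2_norm \<Omega> g)\<^sup>2 - 4 * (L2_norm \<Omega> (\<lambda>x. (1/2) *\<^sub>R (f x + g x)))\<^sup>2"
proof -
  have "4 * (L2_norm \<Omega> (\<lambda>x. (1/2) *\<^sub>R (f x + g x)))\<^sup>2 = (L2_norm \<Omega> (\<lambda>x. f x + g x))\<^sup>2"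
    unfolding L2_norm_scaleR by (simp add: power_mult_distrib power2_eq_square)
  then show ?thesis
    using L2_norm_add_scaleR_power2[OF assms, of 1] L2_norm_add_scaleR_power2[OF assms, of "-1"] by simp
qed

text \<open>A minimizing sequence of test gradients is Cauchy by the parallelogram law. By the Poincare
  inequality its potentials are Cauchy as well, so the limit is again the gradient of an element
  of \<open>H\<^sup>1\<^sub>0\<close>; minimality makes the remainder orthogonal to all test gradients.\<close>

lemma orthogonal_projection_onto_gradients:
  fixes p :: "real^'n \<Rightarrow> real^'n"
  assumes \<Omega>: "\<Omega> \<in> lmeasurable" "bounded \<Omega>" and p: "p \<in> L2 \<Omega>"
  shows "\<exists>u g. u \<in> H1_0 \<Omega> \<and> has_grad \<Omega> u g \<and>
    (\<forall>\<psi>\<in>Cc_inf \<Omega>. L2_inner \<Omega> (\<lambda>x. p x - g x) (grad \<psi>) = 0)"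
proof -
  note \<Omega>' = fmeasurableD[OF \<Omega>(1)]
  have L2: "\<phi> \<in> L2 \<Omega>" "grad \<phi> \<in> L2 \<Omega>" "(\<lambda>x. p x - grad \<phi> x) \<in> L2 \<Omega>" if "\<phi> \<in> Cc_inf \<Omega>" for \<phi>
    by (intro L2_diff p Cc_inf_L2[OF \<Omega>'] Cc_inf_grad that)+
  let ?J = "\<lambda>\<phi>. (L2_norm \<Omega> (\<lambda>x. p x - grad \<phi> x))\<^sup>2"
  define d where "d = (INF \<phi>\<in>Cc_inf \<Omega>. ?J \<phi>)"
  have ne: "(Cc_inf \<Omega> :: (real^'n \<Rightarrow> real) set) \<noteq> {}" using Cc_inf_zero by blast
  have bdd: "bdd_below (?J ` Cc_inf \<Omega>)" by (rule bdd_belowI2[of _ 0]) simp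
  have d: "d \<le> ?J \<phi>" if "\<phi> \<in> Cc_inf \<Omega>" for \<phi>
    unfolding d_def by (rule cINF_lower[OF bdd that])
  have "\<exists>\<phi>\<in>Cc_inf \<Omega>. ?J \<phi> < d + 1 / real (Suc k)" for k
    using cINF_less_iff[OF ne bdd, of "d + 1 / real (Suc k)"] unfolding d_def by simp
  then obtain \<phi> where \<phi>: "\<And>k. \<phi> k \<in> Cc_inf \<Omega>" and J: "\<And>k. ?J (\<phi> k) < d + 1 / real (Suc k)"
    by metis
  have close: "(L2_norm \<Omega> (\<lambda>x. grad (\<phi> m) x - grad (\<phi> n) x))\<^sup>2 \<le> 2 / real (Suc m) + 2 / real (Suc n)" for m n
  proof -
    let ?\<mu> = "\<lambda>x. (1/2) *\<^sub>R (\<phi> m x + \<phi> n x)"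
    have \<mu>: "?\<mu> \<in> Cc_inf \<Omega>" by (intro Cc_inf_scaleR Cc_inf_add \<phi>)
    have "grad ?\<mu> = (\<lambda>x. (1/2) *\<^sub>R (grad (\<phi> m) x + grad (\<phi> n) x))"
      by (simp only: grad_scaleR[OF Cc_inf_add[OF \<phi> \<phi>]] grad_add[OF \<phi> \<phi>])
    moreover have "p x - (1/2) *\<^sub>R (a + b) = (1/2) *\<^sub>R ((p x - a) + (p x - b))" for x a b
      by (simp add: vec_eq_iff field_simps)
    ultimately have "(\<lambda>x. (1/2) *\<^sub>R ((p x - grad (\<phi> m) x) + (p x - grad (\<phi> n) x))) = (\<lambda>x. p x - grad ?\<mu> x)"
      by simp
    with L2_parallelogram[OF L2(3)[OF \<phi>] L2(3)[OF \<phi>], of m n]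
    have "(L2_norm \<Omega> (\<lambda>x. grad (\<phi> n) x - grad (\<phi> m) x))\<^sup>2 = 2 * ?J (\<phi> m) + 2 * ?J (\<phi> n) - 4 * ?J ?\<mu>"
      by simp
    then show ?thesis
      using J[of m] J[of n] d[OF \<mu>] L2_norm_minus_commute[of \<Omega> "grad (\<phi> n)"] by simp
  qed
  have Cauchy: "\<exists>N. \<forall>m\<ge>N. \<forall>n\<ge>N. L2_norm \<Omega> (\<lambda>x. grad (\<phi> m) x - grad (\<phi> n) x) < e" if "e > 0" for e
  proof -
    have "0 < e\<^sup>2 / 4" using that by simp
    then obtain N where N: "1 / real (Suc N) < e\<^sup>2 / 4"
      using reals_Archimedean[of "e\<^sup>2 / 4"] by (auto simp: inverse_eq_divide)
    have "L2_norm \<Omega> (\<lambda>x. grad (\<phi> m) x - grad (\<phi> n) x) < e" if "m \<ge> N" "n \<ge> N" for m n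
    proof -
      have "1 / real (Suc m) \<le> 1 / real (Suc N)" "1 / real (Suc n) \<le> 1 / real (Suc N)"
        using that by (simp_all add: frac_le)
      then have "(L2_norm \<Omega> (\<lambda>x. grad (\<phi> m) x - grad (\<phi> n) x))\<^sup>2 < e\<^sup>2"
        using close[of m n] N by simp
      then show ?thesis
        by (rule power2_less_imp_less) (use \<open>e > 0\<close> in simp)
    qed
    then show ?thesis by blast
  qed
  obtain g where g: "g \<in> L2 \<Omega>" "(\<lambda>k. L2_norm \<Omega> (\<lambda>x. grad (\<phi> k) x - g x)) \<longlonglongrightarrow> 0"
    using L2_complete[OF \<Omega>(1) L2(2)[OF \<phi>] Cauchy] by blast
  obtain C where C: "C > 0" "\<And>\<phi>. \<phi> \<in> Cc_inf \<Omega> \<Longrightarrow> L2_norm \<Omega> \<phi> \<le> C * L2_norm \<Omega> (grad \<phi>)"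
    using Poincare[OF \<Omega>' \<Omega>(2)] by blast
  have Cauchy': "\<exists>N. \<forall>m\<ge>N. \<forall>n\<ge>N. L2_norm \<Omega> (\<lambda>x. \<phi> m x - \<phi> n x) < e" if "e > 0" for e
  proof -
    have "L2_norm \<Omega> (\<lambda>x. \<phi> m x - \<phi> n x) < e"
      if "L2_norm \<Omega> (\<lambda>x. grad (\<phi> m) x - grad (\<phi> n) x) < e / C" for m n
      using C(2)[OF Cc_inf_diff[OF \<phi> \<phi>], of m n] that C(1)
      by (simp add: grad_diff[OF \<phi> \<phi>] pos_less_divide_eq mult.commute)
    then show ?thesis
      using Cauchy[of "e / C"] that C(1) by (meson divide_pos_pos)
  qed
  obtain u where u: "u \<in> L2 \<Omega>" "(\<lambda>k. L2_norm \<Omega> (\<lambda>x. \<phi> k x - u x)) \<longlonglongrightarrow> 0"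
    using L2_complete[OF \<Omega>(1) L2(1)[OF \<phi>] Cauchy'] by blast
  have grad: "has_grad \<Omega> u g"
    by (rule has_grad_limit[OF \<Omega>' has_grad_grad[OF \<Omega>' \<phi>] u(1) g(1) u(2) g(2)])
  have "L2_inner \<Omega> (\<lambda>x. p x - g x) (grad \<psi>) = 0" if \<psi>: "\<psi> \<in> Cc_inf \<Omega>" for \<psi>
  proof -
    let ?b = "L2_inner \<Omega> (\<lambda>x. p x - g x) (grad \<psi>)" and ?a = "(L2_norm \<Omega> (grad \<psi>))\<^sup>2"
    have lim: "(\<lambda>k. L2_inner \<Omega> (\<lambda>x. p x - grad (\<phi> k) x) (grad \<psi>)) \<longlonglongrightarrow> ?b"
    proof (rule L2_inner_tendsto[OF L2(3)[OF \<phi>] L2_diff[OF p g(1)] L2(2)[OF \<psi>]])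
      have "(\<lambda>k. L2_norm \<Omega> (\<lambda>x. p x - grad (\<phi> k) x - (p x - g x))) = (\<lambda>k. L2_norm \<Omega> (\<lambda>x. grad (\<phi> k) x - g x))"
        by (subst L2_norm_minus_commute) simp
      with g(2) show "(\<lambda>k. L2_norm \<Omega> (\<lambda>x. p x - grad (\<phi> k) x - (p x - g x))) \<longlonglongrightarrow> 0"
        by simp
    qed
    have pos: "0 \<le> 2 * t * ?b + t\<^sup>2 * ?a" for t
    proof (rule LIMSEQ_le_const)
      show "(\<lambda>k. 1 / real (Suc k) + 2 * t * L2_inner \<Omega> (\<lambda>x. p x - grad (\<phi> k) x) (grad \<psi>) + t\<^sup>2 * ?a)
          \<longlonglongrightarrow> 2 * t * ?b + t\<^sup>2 * ?a"
      proof -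
        have "(\<lambda>k. 1 / real (Suc k)) \<longlonglongrightarrow> 0"
          using LIMSEQ_inverse_real_of_nat by (simp add: inverse_eq_divide)
        from tendsto_add[OF tendsto_add[OF this tendsto_mult_left[OF lim]] tendsto_const]
        show ?thesis by simp
      qed
      have "0 \<le> 1 / real (Suc k) + 2 * t * L2_inner \<Omega> (\<lambda>x. p x - grad (\<phi> k) x) (grad \<psi>) + t\<^sup>2 * ?a" for k
      proof -
        let ?\<mu> = "\<lambda>x. \<phi> k x - t *\<^sub>R \<psi> x"
        have \<mu>: "?\<mu> \<in> Cc_inf \<Omega>" by (intro Cc_inf_diff Cc_inf_scaleR \<phi> \<psi>)
        have "(\<lambda>x. p x - grad ?\<mu> x) = (\<lambda>x. (p x - grad (\<phi> k) x) + t *\<^sub>R grad \<psi> x)"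
          by (simp only: grad_diff[OF \<phi> Cc_inf_scaleR[OF \<psi>]] grad_scaleR[OF \<psi>]) (simp add: algebra_simps)
        with d[OF \<mu>] have "d \<le> (L2_norm \<Omega> (\<lambda>x. (p x - grad (\<phi> k) x) + t *\<^sub>R grad \<psi> x))\<^sup>2"
          by simp
        then show ?thesis
          using J[of k] L2_norm_add_scaleR_power2[OF L2(3)[OF \<phi>] L2(2)[OF \<psi>], of k t] by simp
      qed
      then show "\<exists>N. \<forall>k\<ge>N. 0 \<le> 1 / real (Suc k) + 2 * t * L2_inner \<Omega> (\<lambda>x. p x - grad (\<phi> k) x) (grad \<psi>) + t\<^sup>2 * ?a"
        by blast
    qed
    have "?b\<^sup>2 \<le> ?a * 0"
      by (rule nonneg_quadratic_discriminant) (use pos in simp_all)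
    then show ?thesis by simp
  qed
  then show ?thesis
    using H1_0I[OF \<Omega>' grad \<phi> u(2) g(2)] grad by blast
qed

text \<open>The Maxwell inequality excludes nonzero fields in \<open>H\<^sub>0(curl)\<close> with vanishing curl and divergence.
  The difference of \<open>p\<close> and its projection onto gradients has these properties: it is
  curl-free, stays in the closure of the test fields because gradients of test functions are test
  fields, and orthogonality to test gradients says that its weak divergence vanishes.\<close>

lemma curl_free_is_gradient:
  fixes \<Omega> :: "(real^'n::{finite,wellorder}) set"
  assumes \<Omega>: "open \<Omega>" "bounded \<Omega>"
    and maxwell: "\<And>v w d. v \<in> H0_curl \<Omega> \<inter> H_div \<Omega> \<Longrightarrow> has_curl \<Omega> v w \<Longrightarrow> has_div \<Omega> v d \<Longrightarrow>
      L2_norm \<Omega> v \<le> c_m * sqrt ((L2_norm \<Omega> w)\<^sup>2 + (L2_norm \<Omega> d)\<^sup>2)"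
    and p: "p \<in> H0_curl \<Omega>" "has_curl \<Omega> p (\<lambda>x. 0)"
  shows "\<exists>u\<in>H1_0 \<Omega>. has_grad \<Omega> u p"
proof -
  have lm: "\<Omega> \<in> lmeasurable" using \<Omega> by (simp add: lmeasurable_open)
  note \<Omega>' = fmeasurableD[OF lm]
  have pL2: "p \<in> L2 \<Omega>" using p(2) by (simp add: has_curl_def)
  obtain u g where u: "u \<in> H1_0 \<Omega>" "has_grad \<Omega> u g"
    and orth: "\<And>\<psi>. \<psi> \<in> Cc_inf \<Omega> \<Longrightarrow> L2_inner \<Omega> (\<lambda>x. p x - g x) (grad \<psi>) = 0"
    using orthogonal_projection_onto_gradients[OF lm \<Omega>(2) pL2] by blast
  have gL2: "g \<in> L2 \<Omega>" using u(2) by (simp add: has_grad_def)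
  let ?q = "\<lambda>x. p x - g x"
  have qL2: "?q \<in> L2 \<Omega>" by (rule L2_diff[OF pL2 gL2])
  have curl: "has_curl \<Omega> ?q (\<lambda>x. 0)"
    using has_curl_diff[OF \<Omega>' p(2) has_curl_grad[OF \<Omega>' u(2)]] by simp
  have div: "has_div \<Omega> ?q (\<lambda>x. 0)"
    using orth qL2 by (simp add: has_div_def L2_zero L2_inner_def inner_vec_def)
  have "?q \<in> H0_curl \<Omega>"
    unfolding H0_curl_def Cc_closure_def mem_Collect_eq
  proof (intro conjI allI impI)
    show "\<exists>w. has_curl \<Omega> ?q w" using curl by blast
    fix e :: real assume "e > 0"
    then have "e / 2 > 0" by simp
    then obtain \<phi> z where \<phi>: "\<phi> \<in> Cc_inf \<Omega>" "has_curl \<Omega> (\<lambda>x. p x - \<phi> x) z"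
      and less: "sqrt ((L2_norm \<Omega> (\<lambda>x. p x - \<phi> x))\<^sup>2 + (L2_norm \<Omega> z)\<^sup>2) < e / 2"
      using p(1) unfolding H0_curl_def Cc_closure_def by blast
    obtain \<psi> where \<psi>: "\<psi> \<in> Cc_inf \<Omega>" "L2_norm \<Omega> (\<lambda>x. g x - grad \<psi> x) < e / 2"
      using H1_0_approx[OF \<Omega>(1) lm u \<open>e / 2 > 0\<close>] by blast
    have "has_curl \<Omega> (\<lambda>x. g x - grad \<psi> x) (\<lambda>x. 0)"
      by (rule has_curl_grad[OF \<Omega>' has_grad_diff[OF \<Omega>' u(2) has_grad_grad[OF \<Omega>' \<psi>(1)]]])
    from has_curl_diff[OF \<Omega>' \<phi>(2) this]
    have z: "has_curl \<Omega> (\<lambda>x. ?q x - (\<phi> x - grad \<psi> x)) z"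
      by (simp add: algebra_simps)
    have "L2_norm \<Omega> (\<lambda>x. ?q x - (\<phi> x - grad \<psi> x)) = L2_norm \<Omega> (\<lambda>x. (p x - \<phi> x) + (-1) *\<^sub>R (g x - grad \<psi> x))"
      by (simp add: algebra_simps)
    also have "\<dots> \<le> L2_norm \<Omega> (\<lambda>x. p x - \<phi> x) + L2_norm \<Omega> (\<lambda>x. (-1) *\<^sub>R (g x - grad \<psi> x))"
      by (intro L2_triangle L2_diff L2_scaleR pL2 gL2 Cc_inf_L2[OF \<Omega>'] \<phi> Cc_inf_grad \<psi>)
    also have "L2_norm \<Omega> (\<lambda>x. (-1) *\<^sub>R (g x - grad \<psi> x)) = L2_norm \<Omega> (\<lambda>x. g x - grad \<psi> x)"
      unfolding L2_norm_scaleR by simp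
    finally have "sqrt ((L2_norm \<Omega> (\<lambda>x. ?q x - (\<phi> x - grad \<psi> x)))\<^sup>2 + (L2_norm \<Omega> z)\<^sup>2) \<le>
        sqrt ((L2_norm \<Omega> (\<lambda>x. p x - \<phi> x) + L2_norm \<Omega> (\<lambda>x. g x - grad \<psi> x))\<^sup>2 + (L2_norm \<Omega> z + 0)\<^sup>2)"
      by (intro real_sqrt_le_mono add_mono power_mono) auto
    also have "\<dots> \<le> sqrt ((L2_norm \<Omega> (\<lambda>x. p x - \<phi> x))\<^sup>2 + (L2_norm \<Omega> z)\<^sup>2) +
        sqrt ((L2_norm \<Omega> (\<lambda>x. g x - grad \<psi> x))\<^sup>2 + 0\<^sup>2)"
      by (rule real_sqrt_sum_squares_triangle_ineq)
    also have "\<dots> < e"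
      using less \<psi>(2) by simp
    finally show "\<exists>\<phi>\<in>Cc_inf \<Omega>. \<exists>z. has_curl \<Omega> (\<lambda>x. ?q x - \<phi> x) z \<and>
        sqrt ((L2_norm \<Omega> (\<lambda>x. ?q x - \<phi> x))\<^sup>2 + (L2_norm \<Omega> z)\<^sup>2) < e"
      using z Cc_inf_diff[OF \<phi>(1) Cc_inf_grad[OF \<psi>(1)]]
      by (intro bexI[of _ "\<lambda>x. \<phi> x - grad \<psi> x"] exI[of _ z] conjI)
  qed
  moreover have "?q \<in> H_div \<Omega>" using div by (auto simp: H_div_def)
  ultimately have "L2_norm \<Omega> ?q \<le> 0"
    using maxwell[OF _ curl div] by simp
  then have "L2_norm \<Omega> ?q = 0"
    using L2_norm_nonneg[of \<Omega> ?q] by linarith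
  from L2_norm_eq_0_AE[OF qL2 this] have "AE x in lebesgue_on \<Omega>. g x = p x"
    by eventually_elim simp
  from has_grad_cong_AE[OF \<Omega>' u(2) pL2 this] u(1) show ?thesis by blast
qed

lemma gradient_in_H0_curl:
  fixes \<Omega> :: "(real^'n::{finite,wellorder}) set"
  assumes \<Omega>: "open \<Omega>" "\<Omega> \<in> lmeasurable" and u: "u \<in> H1_0 \<Omega>" "has_grad \<Omega> u p"
  shows "p \<in> H0_curl \<Omega>"
  unfolding H0_curl_def Cc_closure_def mem_Collect_eq
proof (intro conjI allI impI)
  note \<Omega>' = fmeasurableD[OF \<Omega>(2)]
  show "\<exists>w. has_curl \<Omega> p w" using has_curl_grad[OF \<Omega>' u(2)] by blast
  fix e :: real assume "e > 0"
  then obtain \<psi> where \<psi>: "\<psi> \<in> Cc_inf \<Omega>" "L2_norm \<Omega> (\<lambda>x. p x - grad \<psi> x) < e"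
    using H1_0_approx[OF \<Omega> u] by blast
  have "has_curl \<Omega> (\<lambda>x. p x - grad \<psi> x) (\<lambda>x. 0)"
    by (rule has_curl_grad[OF \<Omega>' has_grad_diff[OF \<Omega>' u(2) has_grad_grad[OF \<Omega>' \<psi>(1)]]])
  moreover have "sqrt ((L2_norm \<Omega> (\<lambda>x. p x - grad \<psi> x))\<^sup>2 + (L2_norm \<Omega> (\<lambda>x. 0::real^'n::_^'n::_))\<^sup>2) < e"
    using \<psi>(2) by simp
  ultimately show "\<exists>\<phi>\<in>Cc_inf \<Omega>. \<exists>z. has_curl \<Omega> (\<lambda>x. p x - \<phi> x) z \<and>
      sqrt ((L2_norm \<Omega> (\<lambda>x. p x - \<phi> x))\<^sup>2 + (L2_norm \<Omega> z)\<^sup>2) < e"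
    using Cc_inf_grad[OF \<psi>(1)] by blast
qed

section \<open>Korn's first inequality\<close>

lemma inner_transpose_transpose:
  fixes A B :: "real^'n^'n"
  shows "transpose A \<bullet> transpose B = A \<bullet> B"
  unfolding inner_vec_def transpose_def by (simp, rule sum.swap)

lemma linear_sym_part: "linear (sym_part :: real^'n^'n \<Rightarrow> real^'n^'n)"
  by (rule linearI) (simp_all add: sym_part_def transpose_def vec_eq_iff algebra_simps)

lemma power2_norm_sym_part:
  "(norm (sym_part A))\<^sup>2 = ((norm A)\<^sup>2 + A \<bullet> transpose A) / 2"
proof -
  have "sym_part A \<bullet> sym_part A = (1/4) * (A \<bullet> A + 2 * (A \<bullet> transpose A) + transpose A \<bullet> transpose A)"
    by (simp add: sym_part_def inner_add_left inner_add_right inner_commute[of "transpose A" A] field_simps)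
  then show ?thesis
    by (simp add: power2_norm_eq_inner inner_transpose_transpose)
qed

lemma norm_sym_part_le: "norm (sym_part A) \<le> norm A"
proof (rule power2_le_imp_le)
  have "A \<bullet> transpose A \<le> norm A * norm (transpose A)"
    by (rule norm_cauchy_schwarz)
  also have "norm (transpose A) = norm A"
    by (simp add: norm_eq_sqrt_inner inner_transpose_transpose)
  finally show "(norm (sym_part A))\<^sup>2 \<le> (norm A)\<^sup>2"
    by (simp add: power2_norm_sym_part) (simp add: power2_eq_square)
qed simp

lemma L2_sym_part:
  assumes "P \<in> L2 \<Omega>"
  shows "(\<lambda>x. sym_part (P x)) \<in> L2 \<Omega>" and "L2_norm \<Omega> (\<lambda>x. sym_part (P x)) \<le> L2_norm \<Omega> P"
proof -
  show sym: "(\<lambda>x. sym_part (P x)) \<in> L2 \<Omega>"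
  proof (rule L2I)
    have "sym_part \<in> borel_measurable borel"
      by (intro borel_measurable_continuous_onI linear_continuous_on linear_conv_bounded_linear[THEN iffD1] linear_sym_part)
    then show "(\<lambda>x. sym_part (P x)) \<in> borel_measurable (lebesgue_on \<Omega>)"
      by (rule measurable_compose[OF L2_measurable[OF assms]])
    show "integrable (lebesgue_on \<Omega>) (\<lambda>x. (norm (P x))\<^sup>2)"
      using assms by (simp add: L2_def)
  qed (simp add: power_mono norm_sym_part_le)
  show "L2_norm \<Omega> (\<lambda>x. sym_part (P x)) \<le> L2_norm \<Omega> P"
    by (rule L2_norm_mono[OF sym assms norm_sym_part_le])
qed

text \<open>Both sides equal \<open>- \<integral> \<partial>\<^sub>i \<partial>\<^sub>j f \<cdot> g\<close>.\<close>

lemma integral_cross_derivatives: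
  fixes f g :: "real^'n \<Rightarrow> real"
  assumes \<Omega>: "\<Omega> \<in> sets lebesgue" and "f \<in> Cc_inf \<Omega>" "g \<in> Cc_inf \<Omega>"
  shows "(\<integral>x. partial_deriv j f x * partial_deriv i g x \<partial>(lebesgue_on \<Omega>)) =
    (\<integral>x. partial_deriv i f x * partial_deriv j g x \<partial>(lebesgue_on \<Omega>))"
proof -
  have parts: "(\<integral>x. partial_deriv j f x * partial_deriv i g x \<partial>(lebesgue_on \<Omega>)) =
      - (\<integral>x. partial_deriv i (partial_deriv j f) x * g x \<partial>(lebesgue_on \<Omega>))" for i j
    by (rule integration_by_parts[OF \<Omega> Cc_inf_C_k[OF Cc_inf_partial_deriv[OF assms(2)]] assms(3)])
  show ?thesis
    unfolding parts by (simp add: mixed_partial_deriv_commute[OF Cc_inf_C_k[OF assms(2)], of i j])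
qed

text \<open>Exchanging derivatives turns \<open>\<integral> Q \<bullet> Q\<^sup>T\<close> into the integral of the squared divergence, which is
  nonnegative; and \<open>2 \<bar>sym Q\<bar>\<^sup>2 = \<bar>Q\<bar>\<^sup>2 + Q \<bullet> Q\<^sup>T\<close> pointwise.\<close>

lemma Korn_test_fields:
  fixes \<psi> :: "'n::finite \<Rightarrow> real^'n \<Rightarrow> real"
  assumes \<Omega>: "\<Omega> \<in> sets lebesgue" and \<psi>: "\<And>n. \<psi> n \<in> Cc_inf \<Omega>"
  defines "Q \<equiv> \<lambda>x. \<chi> n. grad (\<psi> n) x"
  shows "Q \<in> L2 \<Omega>" and "L2_norm \<Omega> Q \<le> sqrt 2 * L2_norm \<Omega> (\<lambda>x. sym_part (Q x))"
proof -
  show Q: "Q \<in> L2 \<Omega>"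
    by (rule L2_vec) (simp add: Q_def Cc_inf_L2[OF \<Omega> Cc_inf_grad[OF \<psi>]] del: grad_nth)
  let ?M = "lebesgue_on \<Omega>"
  have int: "integrable ?M (\<lambda>x. partial_deriv i (\<psi> k) x * partial_deriv j (\<psi> l) x)" for i j k l
    by (intro L2_real_mult_integrable Cc_inf_L2[OF \<Omega>] Cc_inf_partial_deriv \<psi>)
  have "(\<integral>x. Q x \<bullet> transpose (Q x) \<partial>?M) =
      (\<integral>x. (\<Sum>i\<in>UNIV. \<Sum>j\<in>UNIV. partial_deriv j (\<psi> i) x * partial_deriv i (\<psi> j) x) \<partial>?M)"
    by (simp add: Q_def inner_vec_def transpose_def)
  also have "\<dots> = (\<Sum>i\<in>UNIV. \<Sum>j\<in>UNIV. \<integral>x. partial_deriv j (\<psi> i) x * partial_deriv i (\<psi> j) x \<partial>?M)"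
    by (simp add: int)
  also have "\<dots> = (\<Sum>i\<in>UNIV. \<Sum>j\<in>UNIV. \<integral>x. partial_deriv i (\<psi> i) x * partial_deriv j (\<psi> j) x \<partial>?M)"
    by (intro sum.cong refl integral_cross_derivatives[OF \<Omega> \<psi> \<psi>])
  also have "\<dots> = (\<integral>x. (\<Sum>i\<in>UNIV. \<Sum>j\<in>UNIV. partial_deriv i (\<psi> i) x * partial_deriv j (\<psi> j) x) \<partial>?M)"
    by (simp add: int)
  also have "\<dots> = (\<integral>x. (\<Sum>i\<in>UNIV. partial_deriv i (\<psi> i) x)\<^sup>2 \<partial>?M)"
    by (simp add: power2_eq_square sum_product)
  also have "\<dots> \<ge> 0" by simp
  finally have nonneg: "0 \<le> (\<integral>x. Q x \<bullet> transpose (Q x) \<partial>?M)" .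
  have intQ: "integrable ?M (\<lambda>x. (norm (Q x))\<^sup>2)" using Q by (simp add: L2_def)
  have "integrable ?M (\<lambda>x. 2 * (norm (sym_part (Q x)))\<^sup>2 - (norm (Q x))\<^sup>2)"
    using L2_sym_part(1)[OF Q] intQ by (simp add: L2_def)
  moreover have "2 * (norm (sym_part A))\<^sup>2 - (norm A)\<^sup>2 = A \<bullet> transpose A" for A :: "real^'n^'n"
    by (simp add: power2_norm_sym_part field_simps)
  ultimately have intT: "integrable ?M (\<lambda>x. Q x \<bullet> transpose (Q x))"
    by simp
  have "2 * (L2_norm \<Omega> (\<lambda>x. sym_part (Q x)))\<^sup>2 = (L2_norm \<Omega> Q)\<^sup>2 + (\<integral>x. Q x \<bullet> transpose (Q x) \<partial>?M)"
  proof -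
    have sq: "(L2_norm \<Omega> f)\<^sup>2 = (\<integral>x. (norm (f x))\<^sup>2 \<partial>?M)" for f :: "real^'n \<Rightarrow> real^'n^'n"
      by (simp add: L2_norm_def)
    show ?thesis
      unfolding sq power2_norm_sym_part using intQ intT by simp
  qed
  then have "(L2_norm \<Omega> Q)\<^sup>2 \<le> (sqrt 2 * L2_norm \<Omega> (\<lambda>x. sym_part (Q x)))\<^sup>2"
    using nonneg by (simp add: power_mult_distrib)
  then show "L2_norm \<Omega> Q \<le> sqrt 2 * L2_norm \<Omega> (\<lambda>x. sym_part (Q x))"
    by (rule power2_le_imp_le) simp
qed

text \<open>The inequality for test fields survives the limit because taking the symmetric part does not
  increase the norm.\<close>

lemma Korn_H0_Grad:
  fixes \<Omega> :: "(real^'n) set"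
  assumes \<Omega>: "open \<Omega>" "\<Omega> \<in> lmeasurable" and v: "v \<in> H0_Grad \<Omega>" "has_Grad \<Omega> v P"
  shows "L2_norm \<Omega> P \<le> sqrt 2 * L2_norm \<Omega> (\<lambda>x. sym_part (P x))"
proof (rule field_le_epsilon)
  note \<Omega>' = fmeasurableD[OF \<Omega>(2)]
  fix e :: real assume e: "e > 0"
  have row: "has_grad \<Omega> (\<lambda>x. v x $ n) (\<lambda>x. P x $ n)" "(\<lambda>x. v x $ n) \<in> H1_0 \<Omega>" for n
    using v by (simp_all add: has_Grad_def H0_Grad_def)
  have P: "P \<in> L2 \<Omega>"
    by (rule L2_vec(1)) (use row(1) in \<open>simp add: has_grad_def\<close>)
  \<comment> \<open>\<open>CARD('n)\<close> rows, and the error enters once directly and once through the symmetric part, multiplied by \<open>sqrt 2\<close>.\<close>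
  define d where "d = e / ((1 + sqrt 2) * real CARD('n))"
  have d: "d > 0" using e by (simp add: d_def add_pos_pos)
  have "\<exists>\<phi>\<in>Cc_inf \<Omega>. L2_norm \<Omega> (\<lambda>x. P x $ n - grad \<phi> x) < d" for n
    using H1_0_approx[OF \<Omega> row(2,1) d] by blast
  then obtain \<psi> where \<psi>: "\<And>n. \<psi> n \<in> Cc_inf \<Omega>" "\<And>n. L2_norm \<Omega> (\<lambda>x. P x $ n - grad (\<psi> n) x) < d"
    by metis
  define Q where "Q x = (\<chi> n. grad (\<psi> n) x)" for x
  have Q: "Q \<in> L2 \<Omega>" "L2_norm \<Omega> Q \<le> sqrt 2 * L2_norm \<Omega> (\<lambda>x. sym_part (Q x))"
    unfolding Q_def using Korn_test_fields[OF \<Omega>' \<psi>(1)] by auto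
  have D: "(\<lambda>x. P x - Q x) \<in> L2 \<Omega>" by (rule L2_diff[OF P Q(1)])
  have "L2_norm \<Omega> (\<lambda>x. P x - Q x) \<le> (\<Sum>n\<in>UNIV. L2_norm \<Omega> (\<lambda>x. (P x - Q x) $ n))"
    by (rule L2_vec(2)[OF L2_nth[OF D]])
  also have "\<dots> \<le> (\<Sum>n\<in>(UNIV::'n set). d)"
    by (intro sum_mono) (use \<psi>(2) in \<open>simp add: Q_def less_imp_le del: grad_nth\<close>)
  finally have close: "L2_norm \<Omega> (\<lambda>x. P x - Q x) \<le> real CARD('n) * d" by simp
  have "L2_norm \<Omega> P \<le> L2_norm \<Omega> (\<lambda>x. P x - Q x) + L2_norm \<Omega> Q"
    using L2_triangle[OF D Q(1)] by simp
  also have "\<dots> \<le> L2_norm \<Omega> (\<lambda>x. P x - Q x) + sqrt 2 * L2_norm \<Omega> (\<lambda>x. sym_part (Q x))"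
    using Q(2) by simp
  also have "L2_norm \<Omega> (\<lambda>x. sym_part (Q x)) \<le> L2_norm \<Omega> (\<lambda>x. sym_part (P x)) + L2_norm \<Omega> (\<lambda>x. P x - Q x)"
  proof -
    have "sym_part (Q x) = sym_part (P x) + sym_part (Q x - P x)" for x
      by (simp add: linear_diff[OF linear_sym_part])
    then have "L2_norm \<Omega> (\<lambda>x. sym_part (Q x)) = L2_norm \<Omega> (\<lambda>x. sym_part (P x) + sym_part (Q x - P x))"
      by simp
    also have "\<dots> \<le> L2_norm \<Omega> (\<lambda>x. sym_part (P x)) + L2_norm \<Omega> (\<lambda>x. sym_part (Q x - P x))"
      by (intro L2_triangle L2_sym_part P L2_diff Q)
    also have "L2_norm \<Omega> (\<lambda>x. sym_part (Q x - P x)) \<le> L2_norm \<Omega> (\<lambda>x. Q x - P x)"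
      by (intro L2_sym_part L2_diff P Q)
    finally show ?thesis by (simp add: L2_norm_minus_commute[of \<Omega> Q])
  qed
  finally have "L2_norm \<Omega> P \<le> sqrt 2 * L2_norm \<Omega> (\<lambda>x. sym_part (P x)) + (1 + sqrt 2) * L2_norm \<Omega> (\<lambda>x. P x - Q x)"
    by (simp add: algebra_simps)
  also have "(1 + sqrt 2) * L2_norm \<Omega> (\<lambda>x. P x - Q x) \<le> (1 + sqrt 2) * (real CARD('n) * d)"
    using close by (intro mult_left_mono) auto
  also have "\<dots> = e"
  proof -
    have "1 + sqrt 2 \<noteq> 0" using real_sqrt_ge_zero[of 2] by linarith
    then show ?thesis by (simp add: d_def)
  qed
  finally show "L2_norm \<Omega> P \<le> sqrt 2 * L2_norm \<Omega> (\<lambda>x. sym_part (P x)) + e" by simp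
qed

section \<open>Korn's inequality for gradients and curl-free tensor fields\<close>

theorem mainTheorem3:
  fixes \<Omega> :: "(real^'n::{finite,wellorder}) set" and c_m c_hat :: real
  assumes domain: "open \<Omega>" "connected \<Omega>" "\<Omega> \<noteq> {}" "bounded \<Omega>"
    and boundary: "connected (frontier \<Omega>)" "lipschitz_boundary \<Omega>"
    and c_m_pos: "c_m > 0"
    and maxwell: "\<And>v w d. v \<in> H0_curl \<Omega> \<inter> H_div \<Omega> \<Longrightarrow> has_curl \<Omega> v w \<Longrightarrow> has_div \<Omega> v d \<Longrightarrow>
      L2_norm \<Omega> v \<le> c_m * sqrt ((L2_norm \<Omega> w)\<^sup>2 + (L2_norm \<Omega> d)\<^sup>2)"
    and c_hat: "c_hat = max 2 (sqrt 5 * c_m)"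
  shows "(\<forall>v\<in>H0_Grad \<Omega>. \<forall>P. has_Grad \<Omega> v P \<longrightarrow>
            L2_norm \<Omega> P \<le> c_hat * L2_norm \<Omega> (\<lambda>x. sym_part (P x)))
       \<and> Grad_image \<Omega> (H0_Grad \<Omega>) = H0_Curl0 \<Omega>
       \<and> (\<forall>v\<in>H_Grad \<Omega>. \<forall>P. has_Grad \<Omega> v P \<and> P \<in> H0_Curl0 \<Omega> \<longrightarrow>
            L2_norm \<Omega> P \<le> c_hat * L2_norm \<Omega> (\<lambda>x. sym_part (P x)))"
proof -
  have lm: "\<Omega> \<in> lmeasurable" using domain by (simp add: lmeasurable_open)
  note \<Omega>' = fmeasurableD[OF lm]
  have "sqrt 2 \<le> c_hat"
    using real_le_lsqrt[of 2 2] c_hat by simp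
  then have korn: "L2_norm \<Omega> P \<le> c_hat * L2_norm \<Omega> (\<lambda>x. sym_part (P x))"
    if "v \<in> H0_Grad \<Omega>" "has_Grad \<Omega> v P" for v P
    using Korn_H0_Grad[OF domain(1) lm that] by (meson L2_norm_nonneg mult_right_mono order_trans)
  have image: "Grad_image \<Omega> (H0_Grad \<Omega>) = H0_Curl0 \<Omega>"
  proof (intro set_eqI iffI)
    fix P assume "P \<in> Grad_image \<Omega> (H0_Grad \<Omega>)"
    then obtain v where "v \<in> H0_Grad \<Omega>" "has_Grad \<Omega> v P"
      by (auto simp: Grad_image_def)
    then have "(\<lambda>x. v x $ n) \<in> H1_0 \<Omega>" "has_grad \<Omega> (\<lambda>x. v x $ n) (\<lambda>x. P x $ n)" for n
      by (simp_all add: H0_Grad_def has_Grad_def)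
    then have "(\<lambda>x. P x $ n) \<in> H0_curl \<Omega>" "has_curl \<Omega> (\<lambda>x. P x $ n) (\<lambda>x. 0)" for n
      by (blast intro: gradient_in_H0_curl[OF domain(1) lm] has_curl_grad[OF \<Omega>'])+
    then show "P \<in> H0_Curl0 \<Omega>"
      by (simp add: H0_Curl0_def H0_Curl_def has_Curl_def)
  next
    fix P assume "P \<in> H0_Curl0 \<Omega>"
    then have "(\<lambda>x. P x $ n) \<in> H0_curl \<Omega>" "has_curl \<Omega> (\<lambda>x. P x $ n) (\<lambda>x. 0)" for n
      by (simp_all add: H0_Curl0_def H0_Curl_def has_Curl_def)
    then have "\<exists>u\<in>H1_0 \<Omega>. has_grad \<Omega> u (\<lambda>x. P x $ n)" for n
      by (intro curl_free_is_gradient[OF domain(1,4) maxwell])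
    then obtain u where "\<And>n. u n \<in> H1_0 \<Omega>" "\<And>n. has_grad \<Omega> (u n) (\<lambda>x. P x $ n)"
      by metis
    then have "(\<lambda>x. \<chi> n. u n x) \<in> H0_Grad \<Omega>" "has_Grad \<Omega> (\<lambda>x. \<chi> n. u n x) P"
      by (simp_all add: H0_Grad_def has_Grad_def)
    then show "P \<in> Grad_image \<Omega> (H0_Grad \<Omega>)"
      by (auto simp: Grad_image_def)
  qed
  have "L2_norm \<Omega> P \<le> c_hat * L2_norm \<Omega> (\<lambda>x. sym_part (P x))" if "P \<in> H0_Curl0 \<Omega>" for P
    using that korn unfolding image[symmetric] Grad_image_def by blast
  with korn image show ?thesis by blast
qed

end
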